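(* Assume Assumptions 1, 2 and 3. Suppose there exist a sequence $m=m(n)\to\infty$ and $\delta>0$ such that $\tau_2^m\mathbf H_2^2=o(n^2)$ and $\mathbf H_{2+\delta}^2\,\beta(1,3,m)^{\delta/(2+\delta)}=o(1)$. Then $$\frac{1}{n(n-1)}S_n=\frac{1}{n(n-1)}\sum_{i\neq k}\theta_{ik}+o_p(1).$$
   Context: For each $n$, $\mathcal I_n$ is a finite index set with $|\mathcal I_n|=n$, equipped with a metric $\mathbf d:\mathcal I_n\times\mathcal I_n\to[0,\infty]$, and $\{X_i:i\in\mathcal I_n\}$ are random vectors in $\mathbb R^d$ on a probability space $(\Omega,\mathcal F,P)$. For $\mathcal I_1,\mathcal I_2\subset\mathcal I_n$, $\mathbf d(\mathcal I_1,\mathcal I_2)=\inf_{i\in\mathcal I_1,j\in\mathcal I_2}\mathbf d(i,j)$. The $\beta$-mixing coefficient of sub-$\sigma$-algebras is $\beta(\mathcal F_1,\mathcal F_2)=\sup\frac12\sum_{i}\sum_{j}|P(A_i\cap B_j)-P(A_i)P(B_j)|$, the sup over finite partitions $\{A_i\}\subset\mathcal F_1$, $\{B_j\}\subset\mathcal F_2$ of $\Omega$. $\mathcal P_n(n_1,n_2,m)$ is the set of pairs $(\mathcal I_1,\mathcal I_2)$ of subsets of $\mathcal I_n$ with $|\mathcal I_1|\le n_1$, $|\mathcal I_2|\le n_2$, $\mathbf d(\mathcal I_1,\mathcal I_2)\ge m$ ($n_1,n_2$ may be $\infty$). Assumption 1: $\mathbf d(i,j)\ge 1$ for all $n$ and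 all $i\ne j$. Assumption 2: there are numbers $\beta_n(n_1,n_2,m)$ with $\sup_{(\mathcal I_1,\mathcal I_2)\in\mathcal P_n(n_1,n_2,m)}\beta(\sigma(X_i:i\in\mathcal I_1),\sigma(X_i:i\in\mathcal I_2))\le\beta_n(n_1,n_2,m)$; $\beta(n_1,n_2,m):=\sup_n\beta_n(n_1,n_2,m)$. Assumption 3: the kernel $H=H_n:\mathbb R^d\times\mathbb R^d\to\mathbb R$ is measurable and symmetric, and $E H_n(X_i,\tilde X_j)^2<\infty$ for all $i\ne j$ and $n$. Notation: $H_{ij}=H(X_i,X_j)$; for $i\neq j$, $\tilde X_j$ denotes a random vector with the law of $X_j$ independent of $X_i$, and $H_{i\tilde j}=H(X_i,\tilde X_j)$; $\mathbf H_p=\sup_{i\ne j}\max\{\|H_{ij}\|_p,\|H_{i\tilde j}\|_p\}$. $S_n=\sum_{i\ne k}H(X_i,X_k)$ (sum over ordered pairs of distinct indices in $\mathcal I_n$). $\hat H_k(x)=E H(X_k,x)$, $\theta_{ik}=E\hat H_k(X_i)$. Sparsity: the $m$-profile $\pi_m(\mathbf i)$ of $\mathbf i\in\mathcal I_n^q$ is the decreasingly ordered vector of the numbers of entries (counting repeats) in each class of the equivalence relation on the entries of $\mathbf i$ generated by "$\mathbf d\le m$" using chains of entries of $\mathbf i$; $\tau^m_{q_1,\dots,q_S}$ is the number of $\mathbf i\in\mathcal I_n^q$ with $\pi_m(\mathbf i)=(q_1,\dots,q_S)$. In particular $\tau_2^m=\#\{(i,j)\in\mathcal I_n^2:\mathbf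 d(i,j)\le m\}$. *)

theory Defs
  imports "HOL-Probability.Probability"
begin

definition gen_sigma :: "'w measure \<Rightarrow> ('i \<Rightarrow> 'w \<Rightarrow> 'a::topological_space) \<Rightarrow> 'i set \<Rightarrow> 'w set set" where
  "gen_sigma M X I = sigma_sets (space M) (\<Union>i\<in>I. {X i -` B \<inter> space M | B. B \<in> sets borel})"

definition is_fin_partition :: "'w measure \<Rightarrow> 'w set set \<Rightarrow> nat \<Rightarrow> (nat \<Rightarrow> 'w set) \<Rightarrow> bool" where
  "is_fin_partition M F k A \<longleftrightarrow>
     (\<forall>i<k. A i \<in> F) \<and> disjoint_family_on A {..<k} \<and> (\<Union>i<k. A i) = space M"

definition beta_coef :: "'w measure \<Rightarrow> 'w set set \<Rightarrow> 'w set set \<Rightarrow> real" where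
  "beta_coef M F1 F2 = Sup {(1/2) * (\<Sum>i<k. \<Sum>j<l. \<bar>measure M (A i \<inter> B j) - measure M (A i) * measure M (B j)\<bar>)
        | k A l B. is_fin_partition M F1 k A \<and> is_fin_partition M F2 l B}"

text \<open>Distance between index sets (inf over the empty set is infinity).\<close>
definition set_dist :: "('i \<Rightarrow> 'i \<Rightarrow> ereal) \<Rightarrow> 'i set \<Rightarrow> 'i set \<Rightarrow> ereal" where
  "set_dist d I1 I2 = (INF i\<in>I1. INF j\<in>I2. d i j)"

definition Lp_norm :: "'x measure \<Rightarrow> real \<Rightarrow> ('x \<Rightarrow> real) \<Rightarrow> ennreal" where
  "Lp_norm N p f = (let I = (\<integral>\<^sup>+ x. ennreal (\<bar>f x\<bar> powr p) \<partial>N) in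
      if I = \<infinity> then \<infinity> else ennreal ((enn2real I) powr (1/p)))"

text \<open>bold H_p for the n-th array: sup over i \<noteq> j of max of ||H(X_i,X_j)||_p and ||H(X_i, X~_j)||_p,
  where X~_j is an independent copy of X_j (law: product of the marginal laws).\<close>
definition Hnorm :: "'w measure \<Rightarrow> 'i set \<Rightarrow> ('i \<Rightarrow> 'w \<Rightarrow> 'a::topological_space) \<Rightarrow> ('a \<Rightarrow> 'a \<Rightarrow> real) \<Rightarrow> real \<Rightarrow> ennreal" where
  "Hnorm M I X H p = (SUP (i,j) \<in> {(i,j). i \<in> I \<and> j \<in> I \<and> i \<noteq> j}.
      max (Lp_norm M p (\<lambda>\<omega>. H (X i \<omega>) (X j \<omega>)))
          (Lp_norm (distr M borel (X i) \<Otimes>\<^sub>M distr M borel (X j)) p (\<lambda>(x,y). H x y)))"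

definition theta :: "'w measure \<Rightarrow> ('i \<Rightarrow> 'w \<Rightarrow> 'a::topological_space) \<Rightarrow> ('a \<Rightarrow> 'a \<Rightarrow> real) \<Rightarrow> 'i \<Rightarrow> 'i \<Rightarrow> real" where
  "theta M X H i k = (\<integral>x. (\<integral>y. H y x \<partial>(distr M borel (X k))) \<partial>(distr M borel (X i)))"

definition tau2 :: "'i set \<Rightarrow> ('i \<Rightarrow> 'i \<Rightarrow> ereal) \<Rightarrow> real \<Rightarrow> nat" where
  "tau2 I d m = card {(i,j). i \<in> I \<and> j \<in> I \<and> d i j \<le> ereal m}"

definition Ssum :: "'i set \<Rightarrow> ('i \<Rightarrow> 'w \<Rightarrow> 'a) \<Rightarrow> ('a \<Rightarrow> 'a \<Rightarrow> real) \<Rightarrow> 'w \<Rightarrow> real" where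
  "Ssum I X H \<omega> = (\<Sum>i\<in>I. \<Sum>k\<in>I - {i}. H (X i \<omega>) (X k \<omega>))"

end

theory Submission
  imports Defs
begin

text \<open>Write the centered sum as a sum of \<open>Y\<^sub>i\<^sub>k = H(X\<^sub>i, X\<^sub>k) - \<theta>\<^sub>i\<^sub>k\<close> and bound its second moment. Quadruples
  \<open>(i, k, j, l)\<close> in which \<open>i\<close> is within distance \<open>m\<close> of \<open>k\<close>, \<open>j\<close> or \<open>l\<close>, or \<open>k\<close> of \<open>j\<close> or \<open>l\<close>, number at most
  \<open>5 \<tau>\<^sub>2 n\<^sup>2\<close>, and each contributes \<open>O(H\<^sub>2\<^sup>2)\<close>. For any other quadruple, two applications of the mixing bound
  show that the law of \<open>(X\<^sub>i, X\<^sub>k, (X\<^sub>j, X\<^sub>l))\<close> differs from the product of its three marginals by at most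
  \<open>2 \<beta>(1, 3, m)\<close> in total variation. Under that product law \<open>E Y\<^sub>i\<^sub>k Y\<^sub>j\<^sub>l = 0\<close>, because \<open>\<theta>\<^sub>i\<^sub>k\<close> is the mean of
  \<open>H\<close> under the product of the laws of \<open>X\<^sub>i\<close> and \<open>X\<^sub>k\<close>; truncation at a level adapted to the moment of order
  \<open>2 + \<delta>\<close> turns closeness in total variation into closeness of the expectations.\<close>

text \<open>The coefficient \<beta> is a supremum over finite partitions, so it directly controls
  only unions of cells of a product of two partitions. Such sets form an algebra that generates the
  product sigma-algebra, and approximation in measure carries the estimate to all measurable sets.
  Only one of the two kernels has to be decoupled: once \<open>X\<^sub>i\<close> and
  \<open>X\<^sub>k\<close> are independent of each other and of the pair
  \<open>(X\<^sub>j, X\<^sub>l)\<close>, the first centered factor integrates to zero whatever the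
  joint law of that pair. So the distance between \<open>j\<close> and \<open>l\<close> is never
  tested, which leaves five pairs of indices instead of six, and the largest block to be separated
  from a single index is \<open>{k, j, l}\<close>; hence the arguments 1 and 3 of \<beta>. If a
  kernel has a moment of order q = 2 + \<delta>, a product of two kernels has one of order p = q /
  2. Balancing the truncation errors \<open>T * b\<close> and
  \<open>T powr (1 - p) * K powr p\<close> gives \<open>K * b powr (1 - 1 / p)\<close>, and 1 - 1 /
  p = \<delta> / (2 + \<delta>) is the exponent in the hypothesis.\<close>

section \<open>Total variation\<close>

text \<open>One inequality suffices: for probability measures the converse one follows by passing to
  complements, see \<open>tv_le_sym\<close>.\<close>
definition tv_le :: "'a measure \<Rightarrow> 'a measure \<Rightarrow> real \<Rightarrow> bool" where
  "tv_le P Q b \<longleftrightarrow> (\<forall>C\<in>sets P. emeasure P C \<le> emeasure Q C + ennreal b)"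

lemma tv_le_sym:
  assumes "prob_space P" "prob_space Q" and [simp]: "sets P = sets Q" and tv: "tv_le P Q b" and "0 \<le> b"
  shows "tv_le Q P b"
  unfolding tv_le_def
proof
  fix C assume C: "C \<in> sets Q"
  interpret P: prob_space P by fact
  interpret Q: prob_space Q by fact
  have sp: "space P = space Q" by (rule sets_eq_imp_space_eq) simp
  have "space P - C \<in> sets P" using C sp by auto
  with tv have "emeasure P (space P - C) \<le> emeasure Q (space P - C) + ennreal b"
    unfolding tv_le_def by blast
  hence "ennreal (measure P (space P - C)) \<le> ennreal (measure Q (space Q - C) + b)"
    using \<open>0 \<le> b\<close> by (simp add: P.emeasure_eq_measure Q.emeasure_eq_measure sp)
  hence "measure P (space P - C) \<le> measure Q (space Q - C) + b"
    using \<open>0 \<le> b\<close> by (subst (asm) ennreal_le_iff) (auto intro: add_nonneg_nonneg)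
  hence "measure Q C \<le> measure P C + b"
    using C by (simp add: P.prob_compl Q.prob_compl)
  thus "emeasure Q C \<le> emeasure P C + ennreal b"
    using \<open>0 \<le> b\<close> by (simp add: P.emeasure_eq_measure Q.emeasure_eq_measure flip: ennreal_plus)
qed

lemma tv_le_trans:
  assumes "sets P = sets Q" "tv_le P Q b" "tv_le Q R c" "0 \<le> b" "0 \<le> c"
  shows "tv_le P R (b + c)"
  unfolding tv_le_def
proof
  fix C assume C: "C \<in> sets P"
  have "emeasure P C \<le> emeasure Q C + ennreal b" using assms C by (auto simp: tv_le_def)
  also have "\<dots> \<le> (emeasure R C + ennreal c) + ennreal b"
    using assms C by (intro add_right_mono) (auto simp: tv_le_def)
  finally show "emeasure P C \<le> emeasure R C + ennreal (b + c)"
    using assms by (simp add: ac_simps ennreal_plus)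
qed

text \<open>The inequality holds on every section of the set, and the constant \<open>b\<close>
  integrates to itself because \<open>N\<close> has mass one. This lets a comparison of laws be made
  inside a product with a further independent variable.\<close>

lemma tv_le_pair:
  assumes "prob_space N" "prob_space P" "prob_space Q" and [measurable_cong]: "sets P = sets Q"
    and tv: "tv_le P Q b"
  shows "tv_le (N \<Otimes>\<^sub>M P) (N \<Otimes>\<^sub>M Q) b"
  unfolding tv_le_def
proof
  interpret N: prob_space N by fact
  interpret P: prob_space P by fact
  interpret Q: prob_space Q by fact
  have sets_eq: "sets (N \<Otimes>\<^sub>M P) = sets (N \<Otimes>\<^sub>M Q)"
    by (rule sets_pair_measure_cong) (auto simp: assms)
  fix C assume C: "C \<in> sets (N \<Otimes>\<^sub>M P)"
  have "emeasure (N \<Otimes>\<^sub>M P) C = (\<integral>\<^sup>+x. emeasure P (Pair x -` C) \<partial>N)"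
    by (rule P.emeasure_pair_measure_alt) fact
  also have "\<dots> \<le> (\<integral>\<^sup>+x. emeasure Q (Pair x -` C) + ennreal b \<partial>N)"
    using tv sets_Pair1[OF C] by (intro nn_integral_mono) (auto simp: tv_le_def)
  also have "\<dots> = (\<integral>\<^sup>+x. emeasure Q (Pair x -` C) \<partial>N) + ennreal b"
    using C[unfolded sets_eq] by (subst nn_integral_add)
      (auto simp: N.emeasure_space_1 intro: Q.measurable_emeasure_Pair)
  also have "(\<integral>\<^sup>+x. emeasure Q (Pair x -` C) \<partial>N) = emeasure (N \<Otimes>\<^sub>M Q) C"
    using C[unfolded sets_eq] by (rule Q.emeasure_pair_measure_alt[symmetric])
  finally show "emeasure (N \<Otimes>\<^sub>M P) C \<le> emeasure (N \<Otimes>\<^sub>M Q) C + ennreal b" .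
qed

text \<open>Fubini on the region below the graph of \<open>g\<close>. The cutoff at \<open>T\<close>
  confines the levels to an interval of length \<open>T\<close>, so that an error \<open>b\<close>
  on each superlevel set will cost only \<open>T * b\<close> in the integral.\<close>

lemma nn_integral_layer_cake:
  fixes g :: "'a \<Rightarrow> real"
  assumes "sigma_finite_measure P" and [measurable]: "g \<in> borel_measurable P"
    and g: "\<And>x. 0 \<le> g x" "\<And>x. g x \<le> T"
  shows "(\<integral>\<^sup>+x. ennreal (g x) \<partial>P) =
    (\<integral>\<^sup>+t. indicator {0..<T} t * emeasure P {x \<in> space P. t < g x} \<partial>lborel)"
proof -
  interpret P: sigma_finite_measure P by fact
  interpret pair_sigma_finite P lborel by standard
  have "(\<integral>\<^sup>+x. ennreal (g x) \<partial>P) =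
      (\<integral>\<^sup>+x. (\<integral>\<^sup>+t. indicator {0..<T} t * indicator {t. t < g x} t \<partial>lborel) \<partial>P)"
  proof (rule nn_integral_cong)
    fix x
    have "(\<integral>\<^sup>+t. indicator {0..<T} t * indicator {t. t < g x} t \<partial>lborel) =
        (\<integral>\<^sup>+t. indicator {0..<g x} t \<partial>lborel)"
      using g(2)[of x] by (intro nn_integral_cong) (auto simp: indicator_def)
    also have "\<dots> = ennreal (g x)" using g(1)[of x] by simp
    finally show "ennreal (g x) = (\<integral>\<^sup>+t. indicator {0..<T} t * indicator {t. t < g x} t \<partial>lborel)" ..
  qed
  also have "\<dots> = (\<integral>\<^sup>+t. (\<integral>\<^sup>+x. indicator {0..<T} t * indicator {t. t < g x} t \<partial>P) \<partial>lborel)"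
    by (rule Fubini'[symmetric]) measurable
  also have "\<dots> = (\<integral>\<^sup>+t. indicator {0..<T} t * emeasure P {x \<in> space P. t < g x} \<partial>lborel)"
  proof (rule nn_integral_cong)
    fix t
    have "(\<integral>\<^sup>+x. indicator {0..<T} t * indicator {t. t < g x} t \<partial>P) =
        indicator {0..<T} t * (\<integral>\<^sup>+x. indicator {x \<in> space P. t < g x} x \<partial>P)"
      by (subst nn_integral_cmult[symmetric]) (auto intro!: nn_integral_cong simp: indicator_def)
    thus "(\<integral>\<^sup>+x. indicator {0..<T} t * indicator {t. t < g x} t \<partial>P) =
        indicator {0..<T} t * emeasure P {x \<in> space P. t < g x}" by simp
  qed
  finally show ?thesis .
qed

lemma tv_le_nn_integral_bounded:
  fixes g :: "'a \<Rightarrow> real"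
  assumes "prob_space P" "prob_space Q" and sets_eq: "sets P = sets Q" and tv: "tv_le P Q b"
    and gm[measurable]: "g \<in> borel_measurable P"
    and g: "\<And>x. 0 \<le> g x" "\<And>x. g x \<le> T" and "0 \<le> T" "0 \<le> b"
  shows "(\<integral>\<^sup>+x. ennreal (g x) \<partial>P) \<le> (\<integral>\<^sup>+x. ennreal (g x) \<partial>Q) + ennreal (T * b)"
proof -
  interpret P: prob_space P by fact
  interpret Q: prob_space Q by fact
  interpret pair_sigma_finite Q "lborel :: real measure" by standard
  have sp: "space P = space Q" by (rule sets_eq_imp_space_eq) fact
  have gQ[measurable]: "g \<in> borel_measurable Q"
    using gm unfolding measurable_cong_sets[OF sets_eq refl] .
  have mQ: "(\<lambda>t. emeasure Q {x \<in> space Q. t < g x}) \<in> borel_measurable lborel"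
    by measurable
  have "(\<integral>\<^sup>+x. ennreal (g x) \<partial>P) =
      (\<integral>\<^sup>+t. indicator {0..<T} t * emeasure P {x \<in> space P. t < g x} \<partial>lborel)"
    using g by (intro nn_integral_layer_cake gm) unfold_locales
  also have "\<dots> \<le> (\<integral>\<^sup>+t. indicator {0..<T} t * emeasure Q {x \<in> space Q. t < g x}
      + ennreal b * indicator {0..<T} t \<partial>lborel)"
  proof (rule nn_integral_mono)
    fix t
    have "{x \<in> space P. t < g x} \<in> sets P" by measurable
    hence "emeasure P {x \<in> space P. t < g x} \<le> emeasure Q {x \<in> space P. t < g x} + ennreal b"
      using tv by (auto simp: tv_le_def)
    thus "indicator {0..<T} t * emeasure P {x \<in> space P. t < g x} \<le>
      indicator {0..<T} t * emeasure Q {x \<in> space Q. t < g x} + ennreal b * indicator {0..<T} t"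
      by (auto simp: indicator_def sp)
  qed
  also have "\<dots> = (\<integral>\<^sup>+t. indicator {0..<T} t * emeasure Q {x \<in> space Q. t < g x} \<partial>lborel)
      + ennreal b * emeasure lborel {0..<T}"
    using mQ by (subst nn_integral_add) (auto simp: nn_integral_cmult)
  also have "(\<integral>\<^sup>+t. indicator {0..<T} t * emeasure Q {x \<in> space Q. t < g x} \<partial>lborel) =
      (\<integral>\<^sup>+x. ennreal (g x) \<partial>Q)"
    using g by (intro nn_integral_layer_cake[symmetric] gQ) unfold_locales
  finally show ?thesis
    using \<open>0 \<le> T\<close> \<open>0 \<le> b\<close> by (simp add: ennreal_mult mult.commute)
qed

text \<open>One set \<open>D\<close> must serve both measures, since it is used to carry an
  inequality from one to the other; the induction over the generated sigma-algebra therefore keeps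
  both estimates together.\<close>

lemma sigma_sets_approx_by_algebra:
  fixes e :: real
  assumes "finite_measure P" "finite_measure Q" "algebra \<Omega> G"
    and sP: "sets P = sigma_sets \<Omega> G" and sQ: "sets Q = sigma_sets \<Omega> G"
    and C: "C \<in> sigma_sets \<Omega> G" and e: "0 < e"
  shows "\<exists>D\<in>G. measure P ((C - D) \<union> (D - C)) < e \<and> measure Q ((C - D) \<union> (D - C)) < e"
proof -
  interpret P: finite_measure P by fact
  interpret Q: finite_measure Q by fact
  interpret algebra \<Omega> G by fact
  let ?d = "\<lambda>A B. (A - B) \<union> (B - A)"
  have GP: "D \<in> sets P" "D \<in> sets Q" if "D \<in> G" for D
    using that sP sQ by auto
  show ?thesis using C e
  proof (induction arbitrary: e rule: sigma_sets.induct)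
    case (Basic a)
    thus ?case by (intro bexI[of _ a]) auto
  next
    case Empty
    thus ?case by (intro bexI[of _ "{}"]) auto
  next
    case (Compl a)
    then obtain D where D: "D \<in> G" "measure P (?d a D) < e" "measure Q (?d a D) < e" by blast
    have aPQ: "a \<in> sets P" "a \<in> sets Q" using Compl.hyps sP sQ by auto
    have "measure P (?d (\<Omega> - a) (\<Omega> - D)) \<le> measure P (?d a D)"
      by (rule P.finite_measure_mono) (use aPQ GP[OF D(1)] in auto)
    moreover have "measure Q (?d (\<Omega> - a) (\<Omega> - D)) \<le> measure Q (?d a D)"
      by (rule Q.finite_measure_mono) (use aPQ GP[OF D(1)] in auto)
    ultimately show ?case using D by (intro bexI[of _ "\<Omega> - D"]) auto
  next
    case (Union A)
    have AP: "A i \<in> sets P" and AQ: "A i \<in> sets Q" for i using Union.hyps sP sQ by auto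
    \<comment> \<open>\<open>B N\<close> is what the first \<open>N\<close> sets miss of the union.
      It decreases to the empty set, so one \<open>N\<close> makes it small under both
      measures.\<close>
    define B where "B N = (\<Union>i. A i) - (\<Union>i<N. A i)" for N :: nat
    have BP: "B N \<in> sets P" and BQ: "B N \<in> sets Q" for N
      using AP AQ unfolding B_def by auto
    have dec: "decseq B"
      unfolding B_def decseq_def by (auto intro: order.strict_trans2)
    have int: "(\<Inter>i. B i) = {}"
      unfolding B_def by auto
    have "(\<lambda>N. measure P (B N)) \<longlonglongrightarrow> 0"
      using P.finite_Lim_measure_decseq[of B] BP dec int by auto
    hence 1: "eventually (\<lambda>N. measure P (B N) < e / 2) sequentially"
      using Union.prems by (intro order_tendstoD) auto
    have "(\<lambda>N. measure Q (B N)) \<longlonglongrightarrow> 0"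
      using Q.finite_Lim_measure_decseq[of B] BQ dec int by auto
    hence 2: "eventually (\<lambda>N. measure Q (B N) < e / 2) sequentially"
      using Union.prems by (intro order_tendstoD) auto
    from eventually_conj[OF 1 2] obtain N where N: "measure P (B N) < e / 2" "measure Q (B N) < e / 2"
      by (auto simp: eventually_sequentially)
    \<comment> \<open>\<open>N\<close> errors of this size add up to at most \<open>e / 2\<close>,
      the other half being spent on \<open>B N\<close>; the summand 1 keeps the denominator positive
      when \<open>N = 0\<close>.\<close>
    have pos: "0 < e / (2 * (real N + 1))" using Union.prems by simp
    have "\<forall>i. \<exists>D\<in>G. measure P (?d (A i) D) < e / (2 * (real N + 1)) \<and>
                 measure Q (?d (A i) D) < e / (2 * (real N + 1))"
      using Union.IH[OF pos] by blast
    then obtain D where D: "\<And>i. D i \<in> G" "\<And>i. measure P (?d (A i) (D i)) < e / (2 * (real N + 1))"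
      "\<And>i. measure Q (?d (A i) (D i)) < e / (2 * (real N + 1))" by metis
    have sub: "?d (\<Union>i. A i) (\<Union>i<N. D i) \<subseteq> B N \<union> (\<Union>i<N. ?d (A i) (D i))"
      unfolding B_def by auto
    have bound: "measure R (?d (\<Union>i. A i) (\<Union>i<N. D i)) < e"
      if R: "finite_measure R" "sets R = sigma_sets \<Omega> G" and BN: "measure R (B N) < e / 2"
        and DR: "\<And>i. measure R (?d (A i) (D i)) < e / (2 * (real N + 1))" for R
    proof -
      interpret R: finite_measure R by fact
      have AR: "A i \<in> sets R" "D i \<in> sets R" for i using R AP[of i] GP(1)[OF D(1)[of i]] sP by auto
      have BR: "B N \<in> sets R" using BP sP R by auto
      have "measure R (?d (\<Union>i. A i) (\<Union>i<N. D i)) \<le> measure R (B N \<union> (\<Union>i<N. ?d (A i) (D i)))"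
        by (rule R.finite_measure_mono[OF sub]) (use AR BR in auto)
      also have "\<dots> \<le> measure R (B N) + measure R (\<Union>i<N. ?d (A i) (D i))"
        by (rule measure_Un_le) (use AR BR in auto)
      also have "measure R (\<Union>i<N. ?d (A i) (D i)) \<le> (\<Sum>i<N. measure R (?d (A i) (D i)))"
        by (rule measure_UNION_le) (use AR in auto)
      also have "\<dots> \<le> (\<Sum>i<N. e / (2 * (real N + 1)))"
        by (intro sum_mono less_imp_le DR)
      also have "\<dots> \<le> e / 2" using Union.prems by (simp add: field_simps)
      finally show ?thesis using BN by simp
    qed
    have "(\<Union>i<N. D i) \<in> G" using D(1) by auto
    thus ?case
      using bound[OF assms(1) sP N(1) D(2)] bound[OF assms(2) sQ N(2) D(3)] by blast
  qed
qed

text \<open>Replacing \<open>C\<close> by a set of the algebra costs the measure of a symmetric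
  difference under \<open>P\<close>, and going back costs it under \<open>Q\<close>; both are
  arbitrarily small.\<close>

lemma tv_le_if_on_algebra:
  assumes "prob_space P" "prob_space Q" "algebra \<Omega> G"
    and sP: "sets P = sigma_sets \<Omega> G" and sQ: "sets Q = sigma_sets \<Omega> G"
    and le: "\<And>D. D \<in> G \<Longrightarrow> measure P D \<le> measure Q D + b" and "0 \<le> b"
  shows "tv_le P Q b"
  unfolding tv_le_def
proof
  interpret P: prob_space P by fact
  interpret Q: prob_space Q by fact
  fix C assume C: "C \<in> sets P"
  have "measure P C \<le> measure Q C + b"
  proof (rule field_le_epsilon)
    fix e :: real assume e: "0 < e"
    obtain D where D: "D \<in> G" "measure P ((C - D) \<union> (D - C)) < e / 2"
        "measure Q ((C - D) \<union> (D - C)) < e / 2"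
      using sigma_sets_approx_by_algebra[OF P.finite_measure_axioms Q.finite_measure_axioms assms(3) sP sQ,
          of C "e / 2"] C e sP by auto
    have DP: "D \<in> sets P" "D \<in> sets Q" "C \<in> sets Q" using D(1) sP sQ C by auto
    have "measure P C \<le> measure P (D \<union> ((C - D) \<union> (D - C)))"
      by (rule P.finite_measure_mono) (use DP C in auto)
    also have "\<dots> \<le> measure P D + measure P ((C - D) \<union> (D - C))"
      by (rule measure_Un_le) (use DP C in auto)
    also have "\<dots> \<le> (measure Q D + b) + e / 2" using le[OF D(1)] D(2) by simp
    also have "measure Q D \<le> measure Q (C \<union> ((C - D) \<union> (D - C)))"
      by (rule Q.finite_measure_mono) (use DP C in auto)
    also have "\<dots> \<le> measure Q C + measure Q ((C - D) \<union> (D - C))"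
      by (rule measure_Un_le) (use DP C in auto)
    also have "\<dots> \<le> measure Q C + e / 2" using D(3) by simp
    finally show "measure P C \<le> measure Q C + b + e" by simp
  qed
  thus "emeasure P C \<le> emeasure Q C + ennreal b"
    using \<open>0 \<le> b\<close> by (simp add: P.emeasure_eq_measure Q.emeasure_eq_measure flip: ennreal_plus)
qed

section \<open>Mixing and product laws\<close>

text \<open>Unions of cells of a product of two finite measurable partitions. The partitions are
  encoded by labels \<open>a\<close>, \<open>b\<close> and the chosen cells by a relation
  \<open>R\<close> on labels, so that complements and unions become operations on relations.\<close>

definition grids :: "'a measure \<Rightarrow> 'b measure \<Rightarrow> ('a \<times> 'b) set set" where
  "grids S T = {{z \<in> space S \<times> space T. R (a (fst z)) (b (snd z))} | a b R.
     a \<in> measurable S (count_space (UNIV :: nat set)) \<and> b \<in> measurable T (count_space (UNIV :: nat set)) \<and>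
     finite (a ` space S) \<and> finite (b ` space T)}"

lemma gridsI:
  assumes "a \<in> measurable S (count_space (UNIV :: nat set))" "b \<in> measurable T (count_space (UNIV :: nat set))"
    "finite (a ` space S)" "finite (b ` space T)"
    "C = {z \<in> space S \<times> space T. R (a (fst z)) (b (snd z))}"
  shows "C \<in> grids S T"
  using assms unfolding grids_def by blast

lemma algebra_grids: "algebra (space S \<times> space T) (grids S T)"
  unfolding algebra_iff_Un
proof (intro conjI ballI)
  show "grids S T \<subseteq> Pow (space S \<times> space T)" unfolding grids_def by auto
  show "{} \<in> grids S T"
    by (rule gridsI[of "\<lambda>_. 0" _ "\<lambda>_. 0" _ _ "\<lambda>_ _. False"]) (auto simp: image_constant_conv)
next
  fix C assume "C \<in> grids S T"
  then obtain a b R where *: "a \<in> measurable S (count_space (UNIV :: nat set))"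
    "b \<in> measurable T (count_space (UNIV :: nat set))"
    "finite (a ` space S)" "finite (b ` space T)"
    "C = {z \<in> space S \<times> space T. R (a (fst z)) (b (snd z))}"
    unfolding grids_def by blast
  show "space S \<times> space T - C \<in> grids S T"
    by (rule gridsI[OF *(1-4), of _ "\<lambda>x y. \<not> R x y"]) (auto simp: *)
next
  fix C C' assume "C \<in> grids S T" "C' \<in> grids S T"
  then obtain a b R a' b' R' where *: "a \<in> measurable S (count_space (UNIV :: nat set))"
    "b \<in> measurable T (count_space (UNIV :: nat set))"
    "finite (a ` space S)" "finite (b ` space T)"
    "C = {z \<in> space S \<times> space T. R (a (fst z)) (b (snd z))}"
    and **: "a' \<in> measurable S (count_space (UNIV :: nat set))"
    "b' \<in> measurable T (count_space (UNIV :: nat set))"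
    "finite (a' ` space S)" "finite (b' ` space T)"
    "C' = {z \<in> space S \<times> space T. R' (a' (fst z)) (b' (snd z))}"
    unfolding grids_def by blast
  note [measurable] = *(1,2) **(1,2)
  \<comment> \<open>Pairing the labels gives the common refinement of the partitions, over which
    both sets are unions of cells.\<close>
  show "C \<union> C' \<in> grids S T"
  proof (rule gridsI[of "\<lambda>x. prod_encode (a x, a' x)" S "\<lambda>y. prod_encode (b y, b' y)" T _
        "\<lambda>x y. R (fst (prod_decode x)) (fst (prod_decode y)) \<or> R' (snd (prod_decode x)) (snd (prod_decode y))"])
    show "(\<lambda>x. prod_encode (a x, a' x)) \<in> measurable S (count_space UNIV)" by measurable
    show "(\<lambda>y. prod_encode (b y, b' y)) \<in> measurable T (count_space UNIV)" by measurable
    show "finite ((\<lambda>x. prod_encode (a x, a' x)) ` space S)"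
      by (rule finite_subset[of _ "prod_encode ` (a ` space S \<times> a' ` space S)"]) (use * ** in auto)
    show "finite ((\<lambda>y. prod_encode (b y, b' y)) ` space T)"
      by (rule finite_subset[of _ "prod_encode ` (b ` space T \<times> b' ` space T)"]) (use * ** in auto)
  qed (auto simp: * **)
qed

lemma sets_pair_eq_sigma_grids: "sets (S \<Otimes>\<^sub>M T) = sigma_sets (space S \<times> space T) (grids S T)"
proof (rule antisym)
  show "sets (S \<Otimes>\<^sub>M T) \<subseteq> sigma_sets (space S \<times> space T) (grids S T)"
    unfolding sets_pair_measure
  proof (rule sigma_sets_mono, safe)
    fix A B assume AB: "A \<in> sets S" "B \<in> sets T"
    \<comment> \<open>A rectangle is one cell of the two-piece partitions given by \<open>A\<close>,
      \<open>B\<close> and their complements.\<close>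
    show "A \<times> B \<in> sigma_sets (space S \<times> space T) (grids S T)"
    proof (rule sigma_sets.Basic, rule gridsI[of "\<lambda>x. if x \<in> A then 1 else 0" _ "\<lambda>y. if y \<in> B then 1 else 0" _ _
        "\<lambda>s t. s = 1 \<and> t = 1"])
      show "finite ((\<lambda>x. if x \<in> A then 1 else 0 :: nat) ` space S)"
        by (rule finite_subset[of _ "{0, 1}"]) auto
      show "finite ((\<lambda>y. if y \<in> B then 1 else 0 :: nat) ` space T)"
        by (rule finite_subset[of _ "{0, 1}"]) auto
      show "A \<times> B = {z \<in> space S \<times> space T. (if fst z \<in> A then 1 else 0 :: nat) = 1 \<and>
             (if snd z \<in> B then 1 else 0 :: nat) = 1}"
        using sets.sets_into_space[OF AB(1)] sets.sets_into_space[OF AB(2)] by auto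
    qed (use AB in measurable)
  qed
  have "grids S T \<subseteq> sets (S \<Otimes>\<^sub>M T)"
  proof
    fix C assume "C \<in> grids S T"
    then obtain a b R where *[measurable]: "a \<in> measurable S (count_space (UNIV :: nat set))"
      "b \<in> measurable T (count_space (UNIV :: nat set))"
      and C: "C = {z \<in> space S \<times> space T. R (a (fst z)) (b (snd z))}"
      unfolding grids_def by blast
    have "{z \<in> space (S \<Otimes>\<^sub>M T). R (a (fst z)) (b (snd z))} \<in> sets (S \<Otimes>\<^sub>M T)" by measurable
    thus "C \<in> sets (S \<Otimes>\<^sub>M T)" by (simp add: C space_pair_measure)
  qed
  thus "sigma_sets (space S \<times> space T) (grids S T) \<subseteq> sets (S \<Otimes>\<^sub>M T)"
    using sets.sigma_sets_subset[of "grids S T" "S \<Otimes>\<^sub>M T"] by (simp add: space_pair_measure)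
qed

section \<open>Finite partitions and the mixing coefficient\<close>

lemma (in prob_space) fin_partition_sum:
  assumes "F \<subseteq> events" "is_fin_partition M F k A" "E \<in> events"
  shows "(\<Sum>i<k. prob (A i \<inter> E)) = prob E"
proof -
  have A: "A i \<in> events" if "i < k" for i using assms that by (auto simp: is_fin_partition_def)
  have "prob (\<Union>i\<in>{..<k}. A i \<inter> E) = (\<Sum>i<k. prob (A i \<inter> E))"
  proof (rule finite_measure_finite_Union)
    show "disjoint_family_on (\<lambda>i. A i \<inter> E) {..<k}"
      using assms(2) unfolding is_fin_partition_def disjoint_family_on_def by blast
  qed (use assms A in auto)
  also have "(\<Union>i\<in>{..<k}. A i \<inter> E) = E"
    using assms sets.sets_into_space[of E M] by (auto simp: is_fin_partition_def)
  finally show ?thesis by simp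
qed

context prob_space
begin

context
  fixes F1 F2 :: "'a set set" and k l :: nat and A B :: "nat \<Rightarrow> 'a set"
  assumes F: "F1 \<subseteq> events" "F2 \<subseteq> events"
    and part: "is_fin_partition M F1 k A" "is_fin_partition M F2 l B"
begin

lemma partition_marginal_sum:
  "(\<Sum>i<k. prob (A i)) = 1" "(\<Sum>j<l. prob (B j)) = 1"
proof -
  have "(\<Sum>i<k. prob (A i)) = (\<Sum>i<k. prob (A i \<inter> space M))"
    by (rule sum.cong) (use F part in \<open>auto simp: is_fin_partition_def intro!: arg_cong[of _ _ prob]
        dest: sets.sets_into_space\<close>)
  thus "(\<Sum>i<k. prob (A i)) = 1"
    using fin_partition_sum[OF F(1) part(1), of "space M"] by (simp add: prob_space)
  have "(\<Sum>i<l. prob (B i)) = (\<Sum>i<l. prob (B i \<inter> space M))"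
    by (rule sum.cong) (use F part in \<open>auto simp: is_fin_partition_def intro!: arg_cong[of _ _ prob]
        dest: sets.sets_into_space\<close>)
  thus "(\<Sum>j<l. prob (B j)) = 1"
    using fin_partition_sum[OF F(2) part(2), of "space M"] by (simp add: prob_space)
qed

lemma partition_joint_sum: "(\<Sum>i<k. \<Sum>j<l. prob (A i \<inter> B j)) = 1"
proof -
  have "(\<Sum>i<k. \<Sum>j<l. prob (A i \<inter> B j)) = (\<Sum>i<k. prob (A i))"
  proof (rule sum.cong)
    fix i assume "i \<in> {..<k}"
    hence "A i \<in> events" using F part by (auto simp: is_fin_partition_def)
    from fin_partition_sum[OF F(2) part(2) this]
    show "(\<Sum>j<l. prob (A i \<inter> B j)) = prob (A i)" by (simp add: Int_commute)
  qed simp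
  thus ?thesis by (simp add: partition_marginal_sum)
qed

lemma partition_product_sum: "(\<Sum>i<k. \<Sum>j<l. prob (A i) * prob (B j)) = 1"
  by (simp flip: sum_product add: partition_marginal_sum)

text \<open>Joint and product masses of the cells both sum to one. The bound makes the set inside
  \<open>beta_coef\<close> bounded above, without which its real \<open>Sup\<close> would not be
  known to be an upper bound.\<close>

lemma partition_abs_sum_le:
  "(1/2) * (\<Sum>i<k. \<Sum>j<l. \<bar>prob (A i \<inter> B j) - prob (A i) * prob (B j)\<bar>) \<le> 1"
proof -
  have "(\<Sum>i<k. \<Sum>j<l. \<bar>prob (A i \<inter> B j) - prob (A i) * prob (B j)\<bar>) \<le>
      (\<Sum>i<k. \<Sum>j<l. prob (A i \<inter> B j) + prob (A i) * prob (B j))"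
    by (intro sum_mono order_trans[OF abs_triangle_ineq4]) auto
  also have "\<dots> = 2" by (simp add: sum.distrib partition_joint_sum partition_product_sum)
  finally show ?thesis by simp
qed

end

lemma partition_le_beta_coef:
  assumes "F1 \<subseteq> events" "F2 \<subseteq> events" "is_fin_partition M F1 k A" "is_fin_partition M F2 l B"
  shows "(1/2) * (\<Sum>i<k. \<Sum>j<l. \<bar>prob (A i \<inter> B j) - prob (A i) * prob (B j)\<bar>) \<le> beta_coef M F1 F2"
  unfolding beta_coef_def
proof (rule cSup_upper)
  show "bdd_above {(1/2) * (\<Sum>i<k. \<Sum>j<l. \<bar>prob (A i \<inter> B j) - prob (A i) * prob (B j)\<bar>) |k A l B.
      is_fin_partition M F1 k A \<and> is_fin_partition M F2 l B}"
    by (rule bdd_aboveI[of _ 1]) (use partition_abs_sum_le[OF assms(1,2)] in blast)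
qed (use assms in blast)

text \<open>The partitions with a single cell contribute the value 0 to the supremum.\<close>

lemma beta_coef_nonneg:
  assumes "F1 \<subseteq> events" "F2 \<subseteq> events" "space M \<in> F1" "space M \<in> F2"
  shows "0 \<le> beta_coef M F1 F2"
proof -
  have p: "is_fin_partition M F 1 (\<lambda>_. space M)" if "space M \<in> F" for F
    using that by (auto simp: is_fin_partition_def disjoint_family_on_def)
  show ?thesis
    using partition_le_beta_coef[OF assms(1,2) p p] assms by (simp add: prob_space)
qed

text \<open>The excess over the selected cells is at most the sum of the positive parts of the
  differences \<open>?D i j\<close>. A positive part is half of the absolute value plus half of the
  difference, and the differences sum to zero, so the factor 1/2 in \<open>beta_coef\<close> is
  exactly what remains.\<close>

lemma partition_cells_le_beta_coef:
  assumes F: "F1 \<subseteq> events" "F2 \<subseteq> events"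
    and part: "is_fin_partition M F1 k A" "is_fin_partition M F2 l B"
  shows "(\<Sum>i<k. \<Sum>j<l. if R i j then prob (A i \<inter> B j) else 0) \<le>
    (\<Sum>i<k. \<Sum>j<l. if R i j then prob (A i) * prob (B j) else 0) + beta_coef M F1 F2"
proof -
  let ?D = "\<lambda>i j. prob (A i \<inter> B j) - prob (A i) * prob (B j)"
  have "(\<Sum>i<k. \<Sum>j<l. if R i j then prob (A i \<inter> B j) else 0) -
      (\<Sum>i<k. \<Sum>j<l. if R i j then prob (A i) * prob (B j) else 0) =
      (\<Sum>i<k. \<Sum>j<l. if R i j then ?D i j else 0)"
    by (simp flip: sum_subtractf) (intro sum.cong, auto)
  also have "\<dots> \<le> (\<Sum>i<k. \<Sum>j<l. (1/2) * \<bar>?D i j\<bar> + (1/2) * ?D i j)"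
    by (intro sum_mono) (auto simp: abs_if field_simps)
  also have "\<dots> = (1/2) * (\<Sum>i<k. \<Sum>j<l. \<bar>?D i j\<bar>) + (1/2) * (\<Sum>i<k. \<Sum>j<l. ?D i j)"
    by (simp only: sum.distrib sum_distrib_left)
  also have "(\<Sum>i<k. \<Sum>j<l. ?D i j) = 0"
    by (simp add: sum_subtractf partition_joint_sum[OF F part] partition_product_sum[OF F part])
  finally show ?thesis using partition_le_beta_coef[OF F part] by simp
qed

end

lemma measure_grid:
  assumes "finite_measure N" and sN: "sets N = sets (S \<Otimes>\<^sub>M T)"
    and [measurable]: "a \<in> measurable S (count_space (UNIV :: nat set))"
      "b \<in> measurable T (count_space (UNIV :: nat set))"
    and ab: "a ` space S \<subseteq> {..<k}" "b ` space T \<subseteq> {..<l}"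
  shows "measure N {z \<in> space S \<times> space T. R (a (fst z)) (b (snd z))} =
    (\<Sum>i<k. \<Sum>j<l. if R i j then measure N ({x \<in> space S. a x = i} \<times> {y \<in> space T. b y = j}) else 0)"
proof -
  interpret N: finite_measure N by fact
  let ?J = "{(i, j). i < k \<and> j < l \<and> R i j}"
  have fin: "finite ?J" by (rule finite_subset[of _ "{..<k} \<times> {..<l}"]) auto
  have "{z \<in> space S \<times> space T. R (a (fst z)) (b (snd z))} =
      (\<Union>p\<in>?J. {x \<in> space S. a x = fst p} \<times> {y \<in> space T. b y = snd p})"
    using ab by (auto simp: image_subset_iff)
  also have "measure N \<dots> = (\<Sum>p\<in>?J. measure N ({x \<in> space S. a x = fst p} \<times> {y \<in> space T. b y = snd p}))"
  proof (rule N.finite_measure_finite_Union[OF fin])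
    show "(\<lambda>p. {x \<in> space S. a x = fst p} \<times> {y \<in> space T. b y = snd p}) ` ?J \<subseteq> sets N"
      unfolding sN by (intro image_subsetI pair_measureI) measurable
  qed (auto simp: disjoint_family_on_def)
  also have "\<dots> = (\<Sum>p\<in>{..<k} \<times> {..<l}. if R (fst p) (snd p)
      then measure N ({x \<in> space S. a x = fst p} \<times> {y \<in> space T. b y = snd p}) else 0)"
    by (rule sum.mono_neutral_cong_left) auto
  finally show ?thesis by (simp add: sum.cartesian_product case_prod_beta)
qed

text \<open>The labels of a grid, pulled back along \<open>U\<close> and \<open>V\<close>, give
  partitions lying in the two sub-sigma-algebras, so grids are covered by the cell estimate and all
  other sets by approximation. \<open>N1\<close> and \<open>N2\<close> carry the sub-sigma-algebras
  in a form in which \<open>measurable\<close> can speak about them.\<close>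

lemma (in prob_space) tv_le_beta_coef:
  assumes N1: "space N1 = space M" "sets N1 \<subseteq> events" and N2: "space N2 = space M" "sets N2 \<subseteq> events"
    and U1: "U \<in> measurable N1 S" and V1: "V \<in> measurable N2 T"
  shows "tv_le (distr M (S \<Otimes>\<^sub>M T) (\<lambda>\<omega>. (U \<omega>, V \<omega>))) (distr M S U \<Otimes>\<^sub>M distr M T V)
    (beta_coef M (sets N1) (sets N2))"
proof -
  have U[measurable]: "U \<in> measurable M S" and V[measurable]: "V \<in> measurable M T"
    using U1 V1 N1 N2 by (auto simp: measurable_def)
  interpret PU: prob_space "distr M S U" by (rule prob_space_distr) fact
  interpret PV: prob_space "distr M T V" by (rule prob_space_distr) fact
  interpret Q: pair_prob_space "distr M S U" "distr M T V" ..
  have PP: "prob_space (distr M (S \<Otimes>\<^sub>M T) (\<lambda>\<omega>. (U \<omega>, V \<omega>)))"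
    by (rule prob_space_distr) measurable
  interpret P: prob_space "distr M (S \<Otimes>\<^sub>M T) (\<lambda>\<omega>. (U \<omega>, V \<omega>))" by fact
  have sQ: "sets (distr M S U \<Otimes>\<^sub>M distr M T V) = sets (S \<Otimes>\<^sub>M T)"
    by (rule sets_pair_measure_cong) auto
  show ?thesis
  proof (rule tv_le_if_on_algebra[OF PP Q.prob_space_axioms algebra_grids[of S T]])
    fix D assume "D \<in> grids S T"
    then obtain a b R where *[measurable]: "a \<in> measurable S (count_space (UNIV :: nat set))"
      "b \<in> measurable T (count_space (UNIV :: nat set))"
      and fin: "finite (a ` space S)" "finite (b ` space T)"
      and D: "D = {z \<in> space S \<times> space T. R (a (fst z)) (b (snd z))}"
      unfolding grids_def by blast
    obtain k l where kl: "a ` space S \<subseteq> {..<k}" "b ` space T \<subseteq> {..<l}"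
      using fin by (meson finite_nat_iff_bounded)
    define A where "A i = U -` {x \<in> space S. a x = i} \<inter> space M" for i
    define B where "B j = V -` {y \<in> space T. b y = j} \<inter> space M" for j
    have partA: "is_fin_partition M (sets N1) k A"
      unfolding is_fin_partition_def
    proof (intro conjI allI impI)
      show "A i \<in> sets N1" for i
        unfolding A_def N1(1)[symmetric] by (rule measurable_sets[OF U1]) measurable
      show "(\<Union>i<k. A i) = space M"
        using kl(1) measurable_space[OF U] unfolding A_def by auto
    qed (auto simp: A_def disjoint_family_on_def)
    have partB: "is_fin_partition M (sets N2) l B"
      unfolding is_fin_partition_def
    proof (intro conjI allI impI)
      show "B i \<in> sets N2" for i
        unfolding B_def N2(1)[symmetric] by (rule measurable_sets[OF V1]) measurable
      show "(\<Union>i<l. B i) = space M"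
        using kl(2) measurable_space[OF V] unfolding B_def by auto
    qed (auto simp: B_def disjoint_family_on_def)
    have P: "measure (distr M (S \<Otimes>\<^sub>M T) (\<lambda>\<omega>. (U \<omega>, V \<omega>)))
        ({x \<in> space S. a x = i} \<times> {y \<in> space T. b y = j}) = prob (A i \<inter> B j)" for i j
      by (subst measure_distr) (auto simp: A_def B_def intro!: arg_cong[of _ _ prob])
    have Q: "measure (distr M S U \<Otimes>\<^sub>M distr M T V)
        ({x \<in> space S. a x = i} \<times> {y \<in> space T. b y = j}) = prob (A i) * prob (B j)" for i j
      by (simp add: measure_def PV.emeasure_pair_measure_Times enn2real_mult emeasure_distr A_def B_def)
    show "measure (distr M (S \<Otimes>\<^sub>M T) (\<lambda>\<omega>. (U \<omega>, V \<omega>))) D \<le>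
        measure (distr M S U \<Otimes>\<^sub>M distr M T V) D + beta_coef M (sets N1) (sets N2)"
      using partition_cells_le_beta_coef[OF N1(2) N2(2) partA partB, of R]
      unfolding D measure_grid[OF P.finite_measure_axioms sets_distr * kl]
        measure_grid[OF Q.finite_measure_axioms sQ * kl] P Q .
  next
    show "0 \<le> beta_coef M (sets N1) (sets N2)"
      by (rule beta_coef_nonneg[OF N1(2) N2(2)]) (use N1 N2 sets.top in metis)+
  qed (simp_all add: sQ sets_pair_eq_sigma_grids)
qed

section \<open>Truncation and moments\<close>

text \<open>Beyond \<open>T\<close> write \<open>x\<close> as
  \<open>x powr (1 - q) * x powr q\<close>; the first exponent is not positive, so the first factor
  is at most \<open>T powr (1 - q)\<close>. The part lost by truncation is thus paid for by the
  \<open>q\<close>-th moment.\<close>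

lemma le_truncation:
  fixes x T q :: real
  assumes "0 \<le> x" "0 < T" "1 \<le> q"
  shows "x \<le> min x T + T powr (1 - q) * x powr q"
proof (cases "x \<le> T")
  case True
  thus ?thesis using assms by simp
next
  case False
  hence x: "0 < x" "T \<le> x" using assms by auto
  have "x = x powr (1 - q) * x powr q" using x by (simp flip: powr_add)
  also have "\<dots> \<le> T powr (1 - q) * x powr q"
    using x assms by (intro mult_right_mono powr_mono2') auto
  finally show ?thesis using assms x by simp
qed

lemma moment_imp_integrable:
  fixes f :: "'a \<Rightarrow> real"
  assumes "prob_space P" and [measurable]: "f \<in> borel_measurable P" and q: "1 \<le> q"
    and "(\<integral>\<^sup>+x. ennreal (\<bar>f x\<bar> powr q) \<partial>P) \<le> ennreal K"
  shows "integrable P f"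
proof (rule integrableI_bounded)
  interpret prob_space P by fact
  have "(\<integral>\<^sup>+x. ennreal (norm (f x)) \<partial>P) \<le> (\<integral>\<^sup>+x. 1 + ennreal (\<bar>f x\<bar> powr q) \<partial>P)"
  proof (rule nn_integral_mono)
    fix x
    have "\<bar>f x\<bar> \<le> 1 + \<bar>f x\<bar> powr q" using le_truncation[of "\<bar>f x\<bar>" 1 q] q by auto
    hence "ennreal (norm (f x)) \<le> ennreal (1 + \<bar>f x\<bar> powr q)" by (intro ennreal_leI) simp
    thus "ennreal (norm (f x)) \<le> 1 + ennreal (\<bar>f x\<bar> powr q)" by simp
  qed
  also have "\<dots> = 1 + (\<integral>\<^sup>+x. ennreal (\<bar>f x\<bar> powr q) \<partial>P)"
    by (subst nn_integral_add) (auto simp: emeasure_space_1)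
  also have "\<dots> \<le> 1 + ennreal K" using assms by (intro add_left_mono)
  also have "\<dots> < \<infinity>" by (simp add: ennreal_add_eq_top less_top)
  finally show "(\<integral>\<^sup>+x. ennreal (norm (f x)) \<partial>P) < \<infinity>" .
qed fact

lemma abs_mean_le_moment:
  fixes f :: "'a \<Rightarrow> real"
  assumes P: "prob_space P" and fm[measurable]: "f \<in> borel_measurable P" and q: "1 \<le> q" and "0 \<le> K"
    and mom: "(\<integral>\<^sup>+x. ennreal (\<bar>f x\<bar> powr q) \<partial>P) \<le> ennreal (K powr q)"
  shows "\<bar>\<integral>x. f x \<partial>P\<bar> \<le> 2 * K"
proof -
  interpret prob_space P by fact
  have int: "integrable P f" by (rule moment_imp_integrable[OF P fm q mom])
  \<comment> \<open>Truncation at a level \<open>L\<close> takes the place of Jensen's inequality,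
    at the price of a factor 2. The level has to be positive while \<open>K\<close> may be 0, so
    \<open>L\<close> is taken above \<open>K\<close> and then lowered to it.\<close>
  have "\<bar>\<integral>x. f x \<partial>P\<bar> / 2 \<le> L" if L: "K < L" for L
  proof -
    have "0 < L" using L \<open>0 \<le> K\<close> by simp
    have "ennreal (\<integral>x. \<bar>f x\<bar> \<partial>P) = (\<integral>\<^sup>+x. ennreal \<bar>f x\<bar> \<partial>P)"
      using int by (intro nn_integral_eq_integral[symmetric]) auto
    also have "\<dots> \<le> (\<integral>\<^sup>+x. ennreal L + ennreal (L powr (1 - q)) * ennreal (\<bar>f x\<bar> powr q) \<partial>P)"
    proof (rule nn_integral_mono)
      fix x
      have "\<bar>f x\<bar> \<le> L + L powr (1 - q) * \<bar>f x\<bar> powr q"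
        using le_truncation[of "\<bar>f x\<bar>" L q] q \<open>0 < L\<close> by auto
      hence "ennreal \<bar>f x\<bar> \<le> ennreal (L + L powr (1 - q) * \<bar>f x\<bar> powr q)" by (rule ennreal_leI)
      thus "ennreal \<bar>f x\<bar> \<le> ennreal L + ennreal (L powr (1 - q)) * ennreal (\<bar>f x\<bar> powr q)"
        using \<open>0 < L\<close> by (simp add: ennreal_mult)
    qed
    also have "\<dots> = ennreal L + ennreal (L powr (1 - q)) * (\<integral>\<^sup>+x. ennreal (\<bar>f x\<bar> powr q) \<partial>P)"
      by (subst nn_integral_add) (auto simp: emeasure_space_1 nn_integral_cmult)
    also have "\<dots> \<le> ennreal L + ennreal (L powr (1 - q)) * ennreal (L powr q)"
      using L \<open>0 \<le> K\<close> q
      by (intro add_left_mono mult_left_mono order_trans[OF mom] ennreal_leI powr_mono2) auto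
    also have "\<dots> = ennreal (2 * L)"
      using \<open>0 < L\<close> by (simp flip: ennreal_mult ennreal_plus powr_add)
    finally have "(\<integral>x. \<bar>f x\<bar> \<partial>P) \<le> 2 * L" using \<open>0 < L\<close> by simp
    thus ?thesis using integral_abs_bound[of P f] by linarith
  qed
  hence "\<bar>\<integral>x. f x \<partial>P\<bar> / 2 \<le> K" by (rule dense_ge)
  thus ?thesis by simp
qed

text \<open>Pointwise, \<open>\<bar>f x - c\<bar>\<close> is at most
  \<open>\<bar>f x\<bar> + 2 * K\<close>, hence at most the larger of
  \<open>2 * \<bar>f x\<bar>\<close> and \<open>4 * K\<close>. After integration at most
  \<open>2 * (4 * K) powr q\<close> is left, and \<open>2 \<le> 2 powr q\<close> absorbs the factor,
  turning 4 into 8.\<close>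

lemma centered_moment_le:
  fixes f :: "'a \<Rightarrow> real"
  assumes "prob_space P" and [measurable]: "f \<in> borel_measurable P" and q: "1 \<le> q" and "0 \<le> K"
    and mom: "(\<integral>\<^sup>+x. ennreal (\<bar>f x\<bar> powr q) \<partial>P) \<le> ennreal (K powr q)" and c: "\<bar>c\<bar> \<le> 2 * K"
  shows "(\<integral>\<^sup>+x. ennreal (\<bar>f x - c\<bar> powr q) \<partial>P) \<le> ennreal ((8 * K) powr q)"
proof -
  interpret prob_space P by fact
  have "(\<integral>\<^sup>+x. ennreal (\<bar>f x - c\<bar> powr q) \<partial>P) \<le>
      (\<integral>\<^sup>+x. ennreal (2 powr q) * ennreal (\<bar>f x\<bar> powr q) + ennreal ((4 * K) powr q) \<partial>P)"
  proof (rule nn_integral_mono)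
    fix x
    have "\<bar>f x - c\<bar> powr q \<le> max (2 * \<bar>f x\<bar>) (4 * K) powr q"
      using c q by (intro powr_mono2) auto
    also have "\<dots> \<le> (2 * \<bar>f x\<bar>) powr q + (4 * K) powr q" by (auto simp: max_def)
    also have "\<dots> = 2 powr q * \<bar>f x\<bar> powr q + (4 * K) powr q" by (simp add: powr_mult)
    finally have "ennreal (\<bar>f x - c\<bar> powr q) \<le> ennreal (2 powr q * \<bar>f x\<bar> powr q + (4 * K) powr q)"
      by (rule ennreal_leI)
    thus "ennreal (\<bar>f x - c\<bar> powr q) \<le>
        ennreal (2 powr q) * ennreal (\<bar>f x\<bar> powr q) + ennreal ((4 * K) powr q)"
      by (simp add: ennreal_mult)
  qed
  also have "\<dots> = ennreal (2 powr q) * (\<integral>\<^sup>+x. ennreal (\<bar>f x\<bar> powr q) \<partial>P) + ennreal ((4 * K) powr q)"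
    by (subst nn_integral_add) (auto simp: emeasure_space_1 nn_integral_cmult)
  also have "\<dots> \<le> ennreal (2 powr q) * ennreal (K powr q) + ennreal ((4 * K) powr q)"
    by (intro add_right_mono mult_left_mono mom) auto
  also have "\<dots> = ennreal ((2 * K) powr q + (4 * K) powr q)"
    using \<open>0 \<le> K\<close> by (simp add: powr_mult ennreal_mult)
  also have "\<dots> \<le> ennreal ((8 * K) powr q)"
  proof (rule ennreal_leI)
    have "(2 * K) powr q + (4 * K) powr q \<le> 2 * (4 * K) powr q"
      using \<open>0 \<le> K\<close> q powr_mono2[of q "2 * K" "4 * K"] by simp
    also have "\<dots> \<le> 2 powr q * (4 * K) powr q"
      using q powr_mono[of 1 q 2] by (intro mult_right_mono) auto
    also have "\<dots> = (8 * K) powr q" using \<open>0 \<le> K\<close> by (simp flip: powr_mult)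
    finally show "(2 * K) powr q + (4 * K) powr q \<le> (8 * K) powr q" .
  qed
  finally show ?thesis .
qed

text \<open>The truncated function is bounded by \<open>T\<close> and moves from \<open>P\<close> to
  \<open>Q\<close> at cost \<open>T * b\<close>; what truncation removed is charged to the moment
  under \<open>P\<close>.\<close>

lemma tv_le_nn_integral_moment:
  fixes f :: "'a \<Rightarrow> real"
  assumes PQ: "prob_space P" "prob_space Q" "sets P = sets Q" "tv_le P Q b"
    and [measurable]: "f \<in> borel_measurable P"
    and f: "\<And>x. 0 \<le> f x" and T: "0 < T" and b: "0 \<le> b" and p: "1 \<le> p" and K: "0 \<le> K"
    and mom: "(\<integral>\<^sup>+x. ennreal (f x powr p) \<partial>P) \<le> ennreal K"
  shows "(\<integral>\<^sup>+x. ennreal (f x) \<partial>P) \<le> (\<integral>\<^sup>+x. ennreal (f x) \<partial>Q) + ennreal (T * b + T powr (1 - p) * K)"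
proof -
  have "(\<integral>\<^sup>+x. ennreal (f x) \<partial>P) \<le>
      (\<integral>\<^sup>+x. ennreal (min (f x) T) + ennreal (T powr (1 - p)) * ennreal (f x powr p) \<partial>P)"
  proof (rule nn_integral_mono)
    fix x
    have "ennreal (f x) \<le> ennreal (min (f x) T + T powr (1 - p) * f x powr p)"
      by (rule ennreal_leI) (use le_truncation[of "f x" T p] f T p in auto)
    thus "ennreal (f x) \<le> ennreal (min (f x) T) + ennreal (T powr (1 - p)) * ennreal (f x powr p)"
      using f[of x] T by (simp add: ennreal_mult)
  qed
  also have "\<dots> = (\<integral>\<^sup>+x. ennreal (min (f x) T) \<partial>P) +
      ennreal (T powr (1 - p)) * (\<integral>\<^sup>+x. ennreal (f x powr p) \<partial>P)"
    by (subst nn_integral_add) (auto simp: nn_integral_cmult)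
  also have "\<dots> \<le> ((\<integral>\<^sup>+x. ennreal (min (f x) T) \<partial>Q) + ennreal (T * b)) + ennreal (T powr (1 - p)) * ennreal K"
    using f T b by (intro add_mono mult_left_mono mom tv_le_nn_integral_bounded[OF PQ]) auto
  also have "\<dots> \<le> ((\<integral>\<^sup>+x. ennreal (f x) \<partial>Q) + ennreal (T * b)) + ennreal (T powr (1 - p)) * ennreal K"
    by (intro add_mono order_refl nn_integral_mono ennreal_leI) auto
  also have "\<dots> = (\<integral>\<^sup>+x. ennreal (f x) \<partial>Q) + ennreal (T * b + T powr (1 - p) * K)"
    using T b K by (simp add: ennreal_mult add.assoc)
  finally show ?thesis .
qed

text \<open>Positive and negative part are treated separately, which produces the factor 2, and each
  is compared in both directions, which is why the moment is bounded under both measures.\<close>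

lemma tv_le_integral_truncation:
  fixes f :: "'a \<Rightarrow> real"
  assumes PQ: "prob_space P" "prob_space Q" and sets_eq: "sets P = sets Q" and tv: "tv_le P Q b"
    and fP[measurable]: "f \<in> borel_measurable P"
    and T: "0 < T" and b: "0 \<le> b" and p: "1 \<le> p" and K: "0 \<le> K"
    and momP: "(\<integral>\<^sup>+x. ennreal (\<bar>f x\<bar> powr p) \<partial>P) \<le> ennreal K"
    and momQ: "(\<integral>\<^sup>+x. ennreal (\<bar>f x\<bar> powr p) \<partial>Q) \<le> ennreal K"
  shows "\<bar>(\<integral>x. f x \<partial>P) - (\<integral>x. f x \<partial>Q)\<bar> \<le> 2 * (T * b + T powr (1 - p) * K)"
proof -
  have fQ[measurable]: "f \<in> borel_measurable Q"
    using fP unfolding measurable_cong_sets[OF sets_eq refl] .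
  \<comment> \<open>Stated for a generic pair of measures, so that it can be used with
    \<open>P\<close> and \<open>Q\<close> exchanged.\<close>
  have *: "(\<integral>x. g x \<partial>P') \<le> (\<integral>x. g x \<partial>Q') + (T * b + T powr (1 - p) * K)"
    if "prob_space P'" "prob_space Q'" "sets P' = sets Q'" "tv_le P' Q' b"
      and gm: "g \<in> borel_measurable P'" "integrable P' g" "integrable Q' g"
      and fm: "(\<integral>\<^sup>+x. ennreal (\<bar>f x\<bar> powr p) \<partial>P') \<le> ennreal K"
      and g: "\<And>x. 0 \<le> g x" "\<And>x. g x \<le> \<bar>f x\<bar>" for g P' Q'
  proof -
    have "(\<integral>\<^sup>+x. ennreal (g x powr p) \<partial>P') \<le> (\<integral>\<^sup>+x. ennreal (\<bar>f x\<bar> powr p) \<partial>P')"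
      using g p by (intro nn_integral_mono ennreal_leI powr_mono2) auto
    also note fm
    finally have "(\<integral>\<^sup>+x. ennreal (g x powr p) \<partial>P') \<le> ennreal K" .
    from tv_le_nn_integral_moment[OF that(1-5) g(1) T b p K this]
    have "ennreal (\<integral>x. g x \<partial>P') \<le> ennreal (\<integral>x. g x \<partial>Q') + ennreal (T * b + T powr (1 - p) * K)"
      using gm g by (simp add: nn_integral_eq_integral)
    also have "\<dots> = ennreal ((\<integral>x. g x \<partial>Q') + (T * b + T powr (1 - p) * K))"
      using T b K g by (intro ennreal_plus[symmetric]) auto
    finally show ?thesis
      using T b K g by (subst (asm) ennreal_le_iff) (auto intro!: add_nonneg_nonneg)
  qed
  have iP: "integrable P f" and iQ: "integrable Q f"
    using moment_imp_integrable[OF PQ(1) fP p momP] moment_imp_integrable[OF PQ(2) fQ p momQ] by auto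
  have split: "(\<integral>x. f x \<partial>N) = (\<integral>x. max 0 (f x) \<partial>N) - (\<integral>x. max 0 (- f x) \<partial>N)"
    if "integrable N f" for N
  proof -
    have "(\<integral>x. f x \<partial>N) = (\<integral>x. max 0 (f x) - max 0 (- f x) \<partial>N)"
      by (intro Bochner_Integration.integral_cong) auto
    also have "\<dots> = (\<integral>x. max 0 (f x) \<partial>N) - (\<integral>x. max 0 (- f x) \<partial>N)"
      using that by (intro Bochner_Integration.integral_diff) auto
    finally show ?thesis .
  qed
  note tv' = tv_le_sym[OF PQ sets_eq tv b]
  have "(\<integral>x. max 0 (f x) \<partial>P) \<le> (\<integral>x. max 0 (f x) \<partial>Q) + (T * b + T powr (1 - p) * K)"
    "(\<integral>x. max 0 (- f x) \<partial>P) \<le> (\<integral>x. max 0 (- f x) \<partial>Q) + (T * b + T powr (1 - p) * K)"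
    using iP iQ by (auto intro!: *[OF PQ sets_eq tv] momP)
  moreover have "(\<integral>x. max 0 (f x) \<partial>Q) \<le> (\<integral>x. max 0 (f x) \<partial>P) + (T * b + T powr (1 - p) * K)"
    "(\<integral>x. max 0 (- f x) \<partial>Q) \<le> (\<integral>x. max 0 (- f x) \<partial>P) + (T * b + T powr (1 - p) * K)"
    using iP iQ by (auto intro!: *[OF PQ(2,1) sets_eq[symmetric] tv'] momQ)
  moreover have "a \<le> c + e \<Longrightarrow> b \<le> d + e \<Longrightarrow> c \<le> a + e \<Longrightarrow> d \<le> b + e \<Longrightarrow>
      \<bar>a - b - (c - d)\<bar> \<le> 2 * e" for a b c d e :: real by linarith
  ultimately show ?thesis unfolding split[OF iP] split[OF iQ] by blast
qed

lemma tv_le_integral_moment: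
  fixes f :: "'a \<Rightarrow> real"
  assumes PQ: "prob_space P" "prob_space Q" and sets_eq: "sets P = sets Q" and tv: "tv_le P Q b"
    and fP: "f \<in> borel_measurable P" and b: "0 \<le> b" and p: "1 < p" and K: "0 \<le> K"
    and momP: "(\<integral>\<^sup>+x. ennreal (\<bar>f x\<bar> powr p) \<partial>P) \<le> ennreal (K powr p)"
    and momQ: "(\<integral>\<^sup>+x. ennreal (\<bar>f x\<bar> powr p) \<partial>Q) \<le> ennreal (K powr p)"
  shows "\<bar>(\<integral>x. f x \<partial>P) - (\<integral>x. f x \<partial>Q)\<bar> \<le> 4 * K * b powr (1 - 1 / p)"
proof -
  have *: "\<bar>(\<integral>x. f x \<partial>P) - (\<integral>x. f x \<partial>Q)\<bar> \<le> 4 * (K + e) * (b + e) powr (1 - 1 / p)" if e: "0 < e" for e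
  proof -
    \<comment> \<open>this truncation level equalises the two terms of the truncation bound; the perturbation by \<open>e\<close>
      makes it positive\<close>
    define T where "T = (K + e) * (b + e) powr (- 1 / p)"
    have "tv_le P Q (b + e)"
      using tv e b unfolding tv_le_def by (force intro: order_trans add_left_mono ennreal_leI)
    moreover have "ennreal (K powr p) \<le> ennreal ((K + e) powr p)"
      using e K p by (intro ennreal_leI powr_mono2) auto
    moreover have "0 < T" unfolding T_def using K b e by (intro mult_pos_pos) auto
    ultimately have "\<bar>(\<integral>x. f x \<partial>P) - (\<integral>x. f x \<partial>Q)\<bar> \<le>
        2 * (T * (b + e) + T powr (1 - p) * (K + e) powr p)"
      using PQ sets_eq fP b e p K momP momQ
      by (intro tv_le_integral_truncation) (auto intro: order_trans)
    also have "T * (b + e) = (K + e) * (b + e) powr (1 - 1 / p)"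
    proof -
      have "(b + e) powr (- 1 / p) * (b + e) powr 1 = (b + e) powr (1 - 1 / p)"
        unfolding powr_add[symmetric] by simp
      thus ?thesis using b e by (simp add: T_def)
    qed
    also have "T powr (1 - p) * (K + e) powr p = (K + e) * (b + e) powr (1 - 1 / p)"
    proof -
      have "T powr (1 - p) * (K + e) powr p =
          ((K + e) powr (1 - p) * (K + e) powr p) * (b + e) powr ((- 1 / p) * (1 - p))"
        using K b e by (simp add: T_def powr_mult powr_powr)
      also have "(K + e) powr (1 - p) * (K + e) powr p = K + e"
        using K e by (simp flip: powr_add)
      also have "(- 1 / p) * (1 - p) = 1 - 1 / p" using p by (simp add: field_simps)
      finally show ?thesis .
    qed
    finally show ?thesis by (simp add: algebra_simps)
  qed
  \<comment> \<open>A positive exponent makes \<open>powr\<close> continuous at base 0 as well, so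
    the limit \<open>e\<close> to 0 also covers \<open>b = 0\<close>.\<close>
  have s: "0 < 1 - 1 / p" using p by simp
  have "((\<lambda>e. 4 * (K + e) * (b + e) powr (1 - 1 / p)) \<longlongrightarrow> 4 * (K + 0) * (b + 0) powr (1 - 1 / p)) (at_right 0)"
    using s b by (intro tendsto_intros tendsto_powr')
      (auto intro!: tendsto_eq_intros intro: eventually_mono[OF eventually_at_right_less[of 0]])
  hence "\<bar>(\<integral>x. f x \<partial>P) - (\<integral>x. f x \<partial>Q)\<bar> \<le> 4 * (K + 0) * (b + 0) powr (1 - 1 / p)"
  proof (rule tendsto_lowerbound)
    show "eventually (\<lambda>e. \<bar>(\<integral>x. f x \<partial>P) - (\<integral>x. f x \<partial>Q)\<bar> \<le> 4 * (K + e) * (b + e) powr (1 - 1 / p)) (at_right 0)"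
      using eventually_at_right_less[of 0] by (rule eventually_mono) (rule *)
  qed simp
  thus ?thesis by simp
qed

text \<open>Finiteness of \<open>h\<close> rules out the infinite branch of \<open>Lp_norm\<close>;
  without it \<open>enn2real\<close> would turn an infinite moment into 0.\<close>

lemma Lp_norm_moment:
  assumes "Lp_norm N q f \<le> h" "h < \<infinity>" "0 < q"
  shows "(\<integral>\<^sup>+x. ennreal (\<bar>f x\<bar> powr q) \<partial>N) \<le> ennreal (enn2real h powr q)"
proof -
  define J where "J = (\<integral>\<^sup>+x. ennreal (\<bar>f x\<bar> powr q) \<partial>N)"
  have J: "J < \<infinity>"
    using assms unfolding Lp_norm_def J_def[symmetric] Let_def
    by (auto split: if_splits simp: less_top top_unique)
  have "ennreal (enn2real J powr (1 / q)) \<le> h"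
    using assms J unfolding Lp_norm_def J_def[symmetric] Let_def by (auto split: if_splits)
  hence "enn2real J powr (1 / q) \<le> enn2real h"
    using enn2real_mono[of "ennreal (enn2real J powr (1 / q))" h] \<open>h < \<infinity>\<close> by simp
  hence "(enn2real J powr (1 / q)) powr q \<le> enn2real h powr q"
    using \<open>0 < q\<close> by (intro powr_mono2) auto
  hence "enn2real J \<le> enn2real h powr q"
    using \<open>0 < q\<close> by (simp add: powr_powr)
  moreover have "J = ennreal (enn2real J)" using J by simp
  ultimately show ?thesis unfolding J_def[symmetric] using ennreal_leI by metis
qed

lemma Hnorm_moment:
  assumes "i \<in> I" "j \<in> I" "i \<noteq> j" "Hnorm M I X H q < \<infinity>" "0 < q"
  shows "(\<integral>\<^sup>+\<omega>. ennreal (\<bar>H (X i \<omega>) (X j \<omega>)\<bar> powr q) \<partial>M) \<le> ennreal (enn2real (Hnorm M I X H q) powr q)"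
    and "(\<integral>\<^sup>+z. ennreal (\<bar>H (fst z) (snd z)\<bar> powr q) \<partial>(distr M borel (X i) \<Otimes>\<^sub>M distr M borel (X j)))
      \<le> ennreal (enn2real (Hnorm M I X H q) powr q)"
proof -
  have "max (Lp_norm M q (\<lambda>\<omega>. H (X i \<omega>) (X j \<omega>)))
          (Lp_norm (distr M borel (X i) \<Otimes>\<^sub>M distr M borel (X j)) q (\<lambda>(x,y). H x y)) \<le> Hnorm M I X H q"
    unfolding Hnorm_def by (rule SUP_upper2[of "(i, j)"]) (use assms in auto)
  hence le: "Lp_norm M q (\<lambda>\<omega>. H (X i \<omega>) (X j \<omega>)) \<le> Hnorm M I X H q"
    "Lp_norm (distr M borel (X i) \<Otimes>\<^sub>M distr M borel (X j)) q (\<lambda>(x,y). H x y) \<le> Hnorm M I X H q"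
    by auto
  show "(\<integral>\<^sup>+\<omega>. ennreal (\<bar>H (X i \<omega>) (X j \<omega>)\<bar> powr q) \<partial>M) \<le> ennreal (enn2real (Hnorm M I X H q) powr q)"
    by (rule Lp_norm_moment[OF le(1) assms(4,5)])
  show "(\<integral>\<^sup>+z. ennreal (\<bar>H (fst z) (snd z)\<bar> powr q) \<partial>(distr M borel (X i) \<Otimes>\<^sub>M distr M borel (X j)))
      \<le> ennreal (enn2real (Hnorm M I X H q) powr q)"
    using Lp_norm_moment[OF le(2) assms(4,5)] by (simp add: case_prod_beta)
qed

section \<open>Integrals over product laws and covariances\<close>

lemma nn_integral_pair_snd:
  assumes "prob_space N" "prob_space R" and [measurable]: "f \<in> borel_measurable R"
  shows "(\<integral>\<^sup>+z. f (snd z) \<partial>(N \<Otimes>\<^sub>M R)) = (\<integral>\<^sup>+y. f y \<partial>R)"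
proof -
  interpret N: prob_space N by fact
  interpret R: prob_space R by fact
  have "(\<integral>\<^sup>+z. f (snd z) \<partial>(N \<Otimes>\<^sub>M R)) = (\<integral>\<^sup>+x. \<integral>\<^sup>+y. f (snd (x, y)) \<partial>R \<partial>N)"
    by (rule R.nn_integral_fst[symmetric]) measurable
  thus ?thesis by (simp add: N.emeasure_space_1)
qed

lemma nn_integral_pair_fst:
  assumes "prob_space N" "prob_space R" and [measurable]: "f \<in> borel_measurable N"
  shows "(\<integral>\<^sup>+z. f (fst z) \<partial>(N \<Otimes>\<^sub>M R)) = (\<integral>\<^sup>+x. f x \<partial>N)"
proof -
  interpret R: prob_space R by fact
  have "(\<integral>\<^sup>+z. f (fst z) \<partial>(N \<Otimes>\<^sub>M R)) = (\<integral>\<^sup>+x. \<integral>\<^sup>+y. f (fst (x, y)) \<partial>R \<partial>N)"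
    by (rule R.nn_integral_fst[symmetric]) measurable
  thus ?thesis by (simp add: R.emeasure_space_1)
qed

lemma nn_integral_triple_12:
  assumes "prob_space R1" "prob_space R2" "prob_space R3"
    and [measurable]: "f \<in> borel_measurable (R1 \<Otimes>\<^sub>M R2)"
  shows "(\<integral>\<^sup>+z. f (fst z, fst (snd z)) \<partial>(R1 \<Otimes>\<^sub>M (R2 \<Otimes>\<^sub>M R3))) = (\<integral>\<^sup>+z. f z \<partial>(R1 \<Otimes>\<^sub>M R2))"
proof -
  interpret R2: prob_space R2 by fact
  interpret R3: prob_space R3 by fact
  interpret R23: pair_prob_space R2 R3 ..
  have "(\<integral>\<^sup>+z. f (fst z, fst (snd z)) \<partial>(R1 \<Otimes>\<^sub>M (R2 \<Otimes>\<^sub>M R3))) =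
      (\<integral>\<^sup>+u. \<integral>\<^sup>+w. f (fst (u, w), fst (snd (u, w))) \<partial>(R2 \<Otimes>\<^sub>M R3) \<partial>R1)"
    by (rule R23.nn_integral_fst[symmetric]) measurable
  also have "\<dots> = (\<integral>\<^sup>+u. \<integral>\<^sup>+x. f (u, x) \<partial>R2 \<partial>R1)"
  proof (rule nn_integral_cong)
    fix u assume [measurable]: "u \<in> space R1"
    show "(\<integral>\<^sup>+w. f (fst (u, w), fst (snd (u, w))) \<partial>(R2 \<Otimes>\<^sub>M R3)) = (\<integral>\<^sup>+x. f (u, x) \<partial>R2)"
      using nn_integral_pair_fst[OF assms(2,3), of "\<lambda>x. f (u, x)"] by simp
  qed
  also have "\<dots> = (\<integral>\<^sup>+z. f z \<partial>(R1 \<Otimes>\<^sub>M R2))"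
    by (rule R2.nn_integral_fst) measurable
  finally show ?thesis .
qed

lemma integral_triple_product:
  fixes a :: "'a \<times> 'b \<Rightarrow> real" and c :: "'c \<Rightarrow> real"
  assumes "prob_space R1" "prob_space R2" "prob_space R3"
    and int: "integrable (R1 \<Otimes>\<^sub>M (R2 \<Otimes>\<^sub>M R3)) (\<lambda>z. a (fst z, fst (snd z)) * c (snd (snd z)))"
    and a: "integrable (R1 \<Otimes>\<^sub>M R2) a"
  shows "(\<integral>z. a (fst z, fst (snd z)) * c (snd (snd z)) \<partial>(R1 \<Otimes>\<^sub>M (R2 \<Otimes>\<^sub>M R3))) =
    (\<integral>z. a z \<partial>(R1 \<Otimes>\<^sub>M R2)) * (\<integral>v. c v \<partial>R3)"
proof -
  interpret R1: prob_space R1 by fact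
  interpret R2: prob_space R2 by fact
  interpret R3: prob_space R3 by fact
  interpret R23: pair_prob_space R2 R3 ..
  interpret R12: pair_prob_space R1 R2 ..
  interpret R123: pair_prob_space R1 "R2 \<Otimes>\<^sub>M R3" ..
  have "(\<integral>z. a (fst z, fst (snd z)) * c (snd (snd z)) \<partial>(R1 \<Otimes>\<^sub>M (R2 \<Otimes>\<^sub>M R3))) =
      (\<integral>u. \<integral>w. a (u, fst w) * c (snd w) \<partial>(R2 \<Otimes>\<^sub>M R3) \<partial>R1)"
    using R123.integral_fst'[OF int] by simp
  \<comment> \<open>Fubini makes the sections integrable only for almost every \<open>u\<close>, so
    the integrands agree almost everywhere.\<close>
  also have "\<dots> = (\<integral>u. (\<integral>x. a (u, x) \<partial>R2) * (\<integral>v. c v \<partial>R3) \<partial>R1)"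
  proof (rule integral_cong_AE)
    show "AE u in R1. (\<integral>w. a (u, fst w) * c (snd w) \<partial>(R2 \<Otimes>\<^sub>M R3)) = (\<integral>x. a (u, x) \<partial>R2) * (\<integral>v. c v \<partial>R3)"
      using R123.AE_integrable_fst'[OF int]
    proof eventually_elim
      case (elim u)
      hence "(\<integral>w. a (u, fst w) * c (snd w) \<partial>(R2 \<Otimes>\<^sub>M R3)) = (\<integral>x. \<integral>v. a (u, x) * c v \<partial>R3 \<partial>R2)"
        using R23.integral_fst'[of "\<lambda>w. a (u, fst w) * c (snd w)"] by simp
      thus ?case by simp
    qed
  qed (use R123.integrable_fst'[OF int] R12.integrable_fst'[OF a] in auto)
  also have "\<dots> = (\<integral>u. \<integral>x. a (u, x) \<partial>R2 \<partial>R1) * (\<integral>v. c v \<partial>R3)" by simp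
  also have "(\<integral>u. \<integral>x. a (u, x) \<partial>R2 \<partial>R1) = (\<integral>z. a z \<partial>(R1 \<Otimes>\<^sub>M R2))"
    by (rule R12.integral_fst'[OF a])
  finally show ?thesis .
qed

text \<open>The arithmetic-geometric mean inequality replaces Cauchy-Schwarz. As both factors share
  the bound \<open>L\<close>, nothing is lost: the two halves add up to the full moment.\<close>

lemma product_moment_le:
  fixes f g :: "'a \<Rightarrow> real"
  assumes [measurable]: "f \<in> borel_measurable N" "g \<in> borel_measurable N"
    and f: "(\<integral>\<^sup>+x. ennreal (\<bar>f x\<bar> powr (2 * p)) \<partial>N) \<le> ennreal (L powr (2 * p))"
    and g: "(\<integral>\<^sup>+x. ennreal (\<bar>g x\<bar> powr (2 * p)) \<partial>N) \<le> ennreal (L powr (2 * p))"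
    and L: "0 \<le> L"
  shows "(\<integral>\<^sup>+x. ennreal (\<bar>f x * g x\<bar> powr p) \<partial>N) \<le> ennreal ((L\<^sup>2) powr p)"
proof -
  have sq: "t powr (2 * p) = (t powr p)\<^sup>2" for t :: real
    by (simp add: power2_eq_square powr_add[symmetric])
  have half: "ennreal (1/2 * s + 1/2 * t) = ennreal (1/2) * ennreal s + ennreal (1/2) * ennreal t"
    if "0 \<le> s" "0 \<le> t" for s t
  proof -
    have "ennreal (1/2 * s + 1/2 * t) = ennreal (1/2 * s) + ennreal (1/2 * t)"
      using that by (intro ennreal_plus) auto
    also have "\<dots> = ennreal (1/2) * ennreal s + ennreal (1/2) * ennreal t"
      using that by (subst (1 2) ennreal_mult) auto
    finally show ?thesis .
  qed
  have "(\<integral>\<^sup>+x. ennreal (\<bar>f x * g x\<bar> powr p) \<partial>N) \<le>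
      (\<integral>\<^sup>+x. ennreal (1/2) * ennreal (\<bar>f x\<bar> powr (2 * p)) + ennreal (1/2) * ennreal (\<bar>g x\<bar> powr (2 * p)) \<partial>N)"
  proof (rule nn_integral_mono)
    fix x
    have "\<bar>f x * g x\<bar> powr p = \<bar>f x\<bar> powr p * \<bar>g x\<bar> powr p" by (simp add: abs_mult powr_mult)
    also have "\<dots> \<le> (1/2) * (\<bar>f x\<bar> powr p)\<^sup>2 + (1/2) * (\<bar>g x\<bar> powr p)\<^sup>2"
      using sum_squares_bound[of "\<bar>f x\<bar> powr p" "\<bar>g x\<bar> powr p"] by simp
    also have "\<dots> = (1/2) * \<bar>f x\<bar> powr (2 * p) + (1/2) * \<bar>g x\<bar> powr (2 * p)" unfolding sq ..
    finally have "ennreal (\<bar>f x * g x\<bar> powr p) \<le> ennreal ((1/2) * \<bar>f x\<bar> powr (2 * p) + (1/2) * \<bar>g x\<bar> powr (2 * p))"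
      by (rule ennreal_leI)
    also have "\<dots> = ennreal (1/2) * ennreal (\<bar>f x\<bar> powr (2 * p)) + ennreal (1/2) * ennreal (\<bar>g x\<bar> powr (2 * p))"
      by (rule half) auto
    finally show "ennreal (\<bar>f x * g x\<bar> powr p) \<le>
      ennreal (1/2) * ennreal (\<bar>f x\<bar> powr (2 * p)) + ennreal (1/2) * ennreal (\<bar>g x\<bar> powr (2 * p))" .
  qed
  also have "\<dots> = ennreal (1/2) * (\<integral>\<^sup>+x. ennreal (\<bar>f x\<bar> powr (2 * p)) \<partial>N) +
      ennreal (1/2) * (\<integral>\<^sup>+x. ennreal (\<bar>g x\<bar> powr (2 * p)) \<partial>N)"
    by (subst nn_integral_add) (auto simp: nn_integral_cmult)
  also have "\<dots> \<le> ennreal (1/2) * ennreal (L powr (2 * p)) + ennreal (1/2) * ennreal (L powr (2 * p))"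
    by (intro add_mono mult_left_mono f g) auto
  also have "\<dots> = ennreal ((1/2) * L powr (2 * p) + (1/2) * L powr (2 * p))"
    by (rule half[symmetric]) auto
  also have "(1/2) * L powr (2 * p) + (1/2) * L powr (2 * p) = (L\<^sup>2) powr p"
    using L by (simp add: sq power2_eq_square powr_mult)
  finally show ?thesis .
qed

text \<open>Under the product law the integral factors through the mean of \<open>a\<close>, which
  is zero. The integral under \<open>P\<close> is therefore itself the difference of two
  expectations, to be bounded with \<open>K\<close> equal to \<open>L\<^sup>2\<close>.\<close>

lemma tv_le_covariance:
  fixes a :: "'a \<times> 'b \<Rightarrow> real" and c :: "'c \<Rightarrow> real"
  assumes P: "prob_space P" and R: "prob_space R1" "prob_space R2" "prob_space R3"
    and sets_eq: "sets P = sets (R1 \<Otimes>\<^sub>M (R2 \<Otimes>\<^sub>M R3))"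
    and tv: "tv_le P (R1 \<Otimes>\<^sub>M (R2 \<Otimes>\<^sub>M R3)) b" and b: "0 \<le> b"
    and am[measurable]: "a \<in> borel_measurable (R1 \<Otimes>\<^sub>M R2)" and [measurable]: "c \<in> borel_measurable R3"
    and p: "1 < p" and L: "0 \<le> L"
    and aP: "(\<integral>\<^sup>+z. ennreal (\<bar>a (fst z, fst (snd z))\<bar> powr (2 * p)) \<partial>P) \<le> ennreal (L powr (2 * p))"
    and aR: "(\<integral>\<^sup>+z. ennreal (\<bar>a z\<bar> powr (2 * p)) \<partial>(R1 \<Otimes>\<^sub>M R2)) \<le> ennreal (L powr (2 * p))"
    and cP: "(\<integral>\<^sup>+z. ennreal (\<bar>c (snd (snd z))\<bar> powr (2 * p)) \<partial>P) \<le> ennreal (L powr (2 * p))"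
    and cR: "(\<integral>\<^sup>+v. ennreal (\<bar>c v\<bar> powr (2 * p)) \<partial>R3) \<le> ennreal (L powr (2 * p))"
    and mean: "(\<integral>z. a z \<partial>(R1 \<Otimes>\<^sub>M R2)) = 0"
  shows "\<bar>\<integral>z. a (fst z, fst (snd z)) * c (snd (snd z)) \<partial>P\<bar> \<le> 4 * L\<^sup>2 * b powr (1 - 1 / p)"
proof -
  interpret R1: prob_space R1 by fact
  interpret R2: prob_space R2 by fact
  interpret R3: prob_space R3 by fact
  interpret R23: pair_prob_space R2 R3 ..
  interpret R12: pair_prob_space R1 R2 ..
  interpret Q: pair_prob_space R1 "R2 \<Otimes>\<^sub>M R3" ..
  let ?Q = "R1 \<Otimes>\<^sub>M (R2 \<Otimes>\<^sub>M R3)"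
  note cong = measurable_cong_sets[OF sets_eq refl]
  have m1: "(\<lambda>z. a (fst z, fst (snd z))) \<in> borel_measurable ?Q" by measurable
  have m2: "(\<lambda>z. c (snd (snd z))) \<in> borel_measurable ?Q" by measurable
  have mP: "(\<lambda>z. a (fst z, fst (snd z))) \<in> borel_measurable P" "(\<lambda>z. c (snd (snd z))) \<in> borel_measurable P"
    unfolding cong by (rule m1 m2)+
  have aQ: "(\<integral>\<^sup>+z. ennreal (\<bar>a (fst z, fst (snd z))\<bar> powr (2 * p)) \<partial>?Q) \<le> ennreal (L powr (2 * p))"
    using nn_integral_triple_12[OF R, of "\<lambda>z. ennreal (\<bar>a z\<bar> powr (2 * p))"] aR by simp
  have cQ: "(\<integral>\<^sup>+z. ennreal (\<bar>c (snd (snd z))\<bar> powr (2 * p)) \<partial>?Q) \<le> ennreal (L powr (2 * p))"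
    using nn_integral_pair_snd[OF R(1) R23.prob_space_axioms, of "\<lambda>w. ennreal (\<bar>c (snd w)\<bar> powr (2 * p))"]
      nn_integral_pair_snd[OF R(2,3), of "\<lambda>v. ennreal (\<bar>c v\<bar> powr (2 * p))"] cR by simp
  note momP = product_moment_le[OF mP aP cP L] and momQ = product_moment_le[OF m1 m2 aQ cQ L]
  have int: "integrable ?Q (\<lambda>z. a (fst z, fst (snd z)) * c (snd (snd z)))"
    by (rule moment_imp_integrable[OF Q.prob_space_axioms _ _ momQ]) (use p in auto)
  have inta: "integrable (R1 \<Otimes>\<^sub>M R2) a"
    by (rule moment_imp_integrable[OF R12.prob_space_axioms am _ aR]) (use p in auto)
  have "(\<integral>z. a (fst z, fst (snd z)) * c (snd (snd z)) \<partial>?Q) = 0"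
    by (simp add: integral_triple_product[OF R int inta] mean)
  thus ?thesis
    using tv_le_integral_moment[OF P Q.prob_space_axioms sets_eq tv _ b p _ momP momQ] mP by simp
qed

section \<open>Second moment of the kernel sum\<close>

text \<open>\<open>gen_sigma\<close> packaged as a measure, so that dependence on the
  \<open>X i\<close> with \<open>i \<in> I\<close> alone becomes a statement about
  \<open>measurable\<close>.\<close>

definition gen_measure :: "'w measure \<Rightarrow> ('i \<Rightarrow> 'w \<Rightarrow> 'a::topological_space) \<Rightarrow> 'i set \<Rightarrow> 'w measure" where
  "gen_measure M X I = sigma (space M) (\<Union>i\<in>I. {X i -` B \<inter> space M | B. B \<in> sets borel})"

lemma space_gen_measure [simp]: "space (gen_measure M X I) = space M"
  and sets_gen_measure: "sets (gen_measure M X I) = gen_sigma M X I"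
proof -
  have "(\<Union>i\<in>I. {X i -` B \<inter> space M | B. B \<in> sets borel}) \<subseteq> Pow (space M)" by auto
  thus "space (gen_measure M X I) = space M" "sets (gen_measure M X I) = gen_sigma M X I"
    by (simp_all add: gen_measure_def gen_sigma_def)
qed

lemma gen_sigma_subset_sets:
  assumes "\<And>i. i \<in> I \<Longrightarrow> X i \<in> borel_measurable M"
  shows "gen_sigma M X I \<subseteq> sets M"
  unfolding gen_sigma_def
  by (rule sets.sigma_sets_subset) (use assms in \<open>auto intro: measurable_sets\<close>)

lemma measurable_gen_measure:
  fixes X :: "'i \<Rightarrow> 'w \<Rightarrow> 'a::topological_space"
  assumes "i \<in> I"
  shows "X i \<in> measurable (gen_measure M X I) borel"
proof (rule measurableI)
  fix B :: "'a set" assume "B \<in> sets borel"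
  thus "X i -` B \<inter> space (gen_measure M X I) \<in> sets (gen_measure M X I)"
    unfolding sets_gen_measure gen_sigma_def space_gen_measure
    using assms by (intro sigma_sets.Basic) blast
qed simp

text \<open>\<open>theta\<close> is an iterated integral with the arguments of \<open>H\<close> in
  reverse order; symmetry of \<open>H\<close> and Fubini turn it into the mean under the product
  law.\<close>

lemma theta_eq_integral:
  fixes X :: "'i \<Rightarrow> 'w \<Rightarrow> 'a::topological_space"
  assumes "prob_space M" and sym: "\<And>x y. H x y = H y x"
    and [measurable]: "X i \<in> borel_measurable M" "X k \<in> borel_measurable M"
    and int: "integrable (distr M borel (X i) \<Otimes>\<^sub>M distr M borel (X k)) (\<lambda>z. H (fst z) (snd z))"
  shows "theta M X H i k = (\<integral>z. H (fst z) (snd z) \<partial>(distr M borel (X i) \<Otimes>\<^sub>M distr M borel (X k)))"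
proof -
  interpret M: prob_space M by fact
  interpret Pi: prob_space "distr M borel (X i)" by (rule M.prob_space_distr) measurable
  interpret Pk: prob_space "distr M borel (X k)" by (rule M.prob_space_distr) measurable
  interpret Q: pair_prob_space "distr M borel (X i)" "distr M borel (X k)" ..
  show ?thesis
    using Q.integral_fst'[OF int] unfolding theta_def by (simp add: sym[of _ "_ :: 'a"])
qed

text \<open>The exponent \<open>q\<close> is a parameter because two instances are needed: 2 for
  quadruples with a close pair, and an exponent above 2 for separated ones.\<close>

locale kernel_pair = prob_space M for M :: "'w measure" +
  fixes X :: "'i \<Rightarrow> 'w \<Rightarrow> 'a::topological_space" and H :: "'a \<Rightarrow> 'a \<Rightarrow> real"
    and I :: "'i set" and q :: real
  assumes X[measurable]: "\<And>i. i \<in> I \<Longrightarrow> X i \<in> borel_measurable M"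
    and H[measurable]: "case_prod H \<in> borel_measurable (borel \<Otimes>\<^sub>M borel)"
    and H_sym: "\<And>x y. H x y = H y x"
    and q: "1 \<le> q"
    and Hnorm_fin: "Hnorm M I X H q < \<infinity>"
begin

abbreviation K :: real where "K \<equiv> enn2real (Hnorm M I X H q)"

lemma measurable_H [measurable (raw)]:
  assumes "f \<in> borel_measurable N" "g \<in> borel_measurable N"
  shows "(\<lambda>x. H (f x) (g x)) \<in> borel_measurable N"
proof -
  have "(\<lambda>x. case_prod H (f x, g x)) \<in> borel_measurable N"
    by (rule measurable_compose[OF _ H]) (use assms in measurable)
  thus ?thesis by simp
qed

context
  fixes i k assumes ik: "i \<in> I" "k \<in> I" "i \<noteq> k"
begin

lemma pair_law: "pair_prob_space (distr M borel (X i)) (distr M borel (X k))"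
  unfolding pair_prob_space_def pair_sigma_finite_def
  using ik by (auto intro!: prob_space_distr prob_space_imp_sigma_finite)

lemma integrable_pair_law:
  "integrable (distr M borel (X i) \<Otimes>\<^sub>M distr M borel (X k)) (\<lambda>z. H (fst z) (snd z))"
proof -
  interpret Q: pair_prob_space "distr M borel (X i)" "distr M borel (X k)" by (rule pair_law)
  show ?thesis
    by (rule moment_imp_integrable[OF Q.prob_space_axioms _ q Hnorm_moment(2)])
      (use ik q Hnorm_fin in auto)
qed

lemma theta_eq:
  "theta M X H i k = (\<integral>z. H (fst z) (snd z) \<partial>(distr M borel (X i) \<Otimes>\<^sub>M distr M borel (X k)))"
  using ik by (intro theta_eq_integral integrable_pair_law H_sym prob_space_axioms) auto

lemma abs_theta_le: "\<bar>theta M X H i k\<bar> \<le> 2 * K"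
proof -
  interpret Q: pair_prob_space "distr M borel (X i)" "distr M borel (X k)" by (rule pair_law)
  show ?thesis
    unfolding theta_eq
    by (rule abs_mean_le_moment[OF Q.prob_space_axioms _ q _ Hnorm_moment(2)])
      (use ik q Hnorm_fin in auto)
qed

lemma centered_kernel_moment:
  "(\<integral>\<^sup>+\<omega>. ennreal (\<bar>H (X i \<omega>) (X k \<omega>) - theta M X H i k\<bar> powr q) \<partial>M) \<le> ennreal ((8 * K) powr q)"
  by (rule centered_moment_le[OF prob_space_axioms _ q enn2real_nonneg _ abs_theta_le])
    (use ik q Hnorm_fin Hnorm_moment(1)[of i I k M X H q] in auto)

text \<open>Comparing expectations requires moments under the decoupled law too; this is where the
  independent copies in \<open>Hnorm\<close> enter.\<close>

lemma centered_kernel_pair_law_moment: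
  "(\<integral>\<^sup>+z. ennreal (\<bar>H (fst z) (snd z) - theta M X H i k\<bar> powr q)
      \<partial>(distr M borel (X i) \<Otimes>\<^sub>M distr M borel (X k))) \<le> ennreal ((8 * K) powr q)"
proof -
  interpret Q: pair_prob_space "distr M borel (X i)" "distr M borel (X k)" by (rule pair_law)
  show ?thesis
    by (rule centered_moment_le[OF Q.prob_space_axioms _ q enn2real_nonneg _ abs_theta_le])
      (use ik q Hnorm_fin Hnorm_moment(2)[of i I k M X H q] in auto)
qed

lemma centered_pair_law_mean:
  "(\<integral>z. H (fst z) (snd z) - theta M X H i k \<partial>(distr M borel (X i) \<Otimes>\<^sub>M distr M borel (X k))) = 0"
proof -
  interpret Q: pair_prob_space "distr M borel (X i)" "distr M borel (X k)" by (rule pair_law)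
  show ?thesis
    using integrable_pair_law Q.prob_space by (simp add: theta_eq)
qed

end

text \<open>First \<open>X i\<close> is split from the other three. The second split compares laws
  of those three only and is carried into the product with the law of \<open>X i\<close> by
  \<open>tv_le_pair\<close>. The pair law \<open>Pjl\<close> stays joint throughout.\<close>

lemma tv_le_decoupled:
  assumes I: "i \<in> I" "k \<in> I" "j \<in> I" "l \<in> I"
  defines "Pjl \<equiv> distr M (borel \<Otimes>\<^sub>M borel) (\<lambda>\<omega>. (X j \<omega>, X l \<omega>))"
  shows "tv_le (distr M (borel \<Otimes>\<^sub>M (borel \<Otimes>\<^sub>M (borel \<Otimes>\<^sub>M borel))) (\<lambda>\<omega>. (X i \<omega>, (X k \<omega>, (X j \<omega>, X l \<omega>)))))
      (distr M borel (X i) \<Otimes>\<^sub>M (distr M borel (X k) \<Otimes>\<^sub>M Pjl))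
      (beta_coef M (gen_sigma M X {i}) (gen_sigma M X {k, j, l}) +
       beta_coef M (gen_sigma M X {k}) (gen_sigma M X {j, l}))"
    and "0 \<le> beta_coef M (gen_sigma M X {i}) (gen_sigma M X {k, j, l})"
    and "0 \<le> beta_coef M (gen_sigma M X {k}) (gen_sigma M X {j, l})"
proof -
  note [measurable] = X[OF I(1)] X[OF I(2)] X[OF I(3)] X[OF I(4)]
  have sub: "gen_sigma M X J \<subseteq> events" if "J \<subseteq> {i, k, j, l}" for J
    by (rule gen_sigma_subset_sets) (use that I X in auto)
  have top: "space M \<in> gen_sigma M X J" for J
    using sets.top[of "gen_measure M X J"] by (simp add: sets_gen_measure)
  show b1: "0 \<le> beta_coef M (gen_sigma M X {i}) (gen_sigma M X {k, j, l})"
    and b2: "0 \<le> beta_coef M (gen_sigma M X {k}) (gen_sigma M X {j, l})"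
    by (intro beta_coef_nonneg sub top; auto)+
  define V where "V = (\<lambda>\<omega>. (X k \<omega>, (X j \<omega>, X l \<omega>)))"
  define P3 where "P3 = distr M (borel \<Otimes>\<^sub>M (borel \<Otimes>\<^sub>M borel)) V"
  have V[measurable]: "V \<in> measurable M (borel \<Otimes>\<^sub>M (borel \<Otimes>\<^sub>M borel))" unfolding V_def by measurable
  interpret Pi: prob_space "distr M borel (X i)" by (rule prob_space_distr) measurable
  interpret Pk: prob_space "distr M borel (X k)" by (rule prob_space_distr) measurable
  interpret Pjl: prob_space Pjl unfolding Pjl_def by (rule prob_space_distr) measurable
  interpret P3: prob_space P3 unfolding P3_def by (rule prob_space_distr) measurable
  interpret Pkjl: pair_prob_space "distr M borel (X k)" Pjl ..
  have "V \<in> measurable (gen_measure M X {k, j, l}) (borel \<Otimes>\<^sub>M (borel \<Otimes>\<^sub>M borel))"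
    unfolding V_def by (intro measurable_Pair measurable_gen_measure) auto
  from tv_le_beta_coef[OF _ _ _ _ measurable_gen_measure[of i "{i}" X M] this]
  have 1: "tv_le (distr M (borel \<Otimes>\<^sub>M (borel \<Otimes>\<^sub>M (borel \<Otimes>\<^sub>M borel))) (\<lambda>\<omega>. (X i \<omega>, V \<omega>)))
      (distr M borel (X i) \<Otimes>\<^sub>M P3) (beta_coef M (gen_sigma M X {i}) (gen_sigma M X {k, j, l}))"
    by (simp add: sets_gen_measure sub P3_def)
  have "(\<lambda>\<omega>. (X j \<omega>, X l \<omega>)) \<in> measurable (gen_measure M X {j, l}) (borel \<Otimes>\<^sub>M borel)"
    by (intro measurable_Pair measurable_gen_measure) auto
  from tv_le_beta_coef[OF _ _ _ _ measurable_gen_measure[of k "{k}" X M] this]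
  have "tv_le P3 (distr M borel (X k) \<Otimes>\<^sub>M Pjl) (beta_coef M (gen_sigma M X {k}) (gen_sigma M X {j, l}))"
    by (simp add: sets_gen_measure sub P3_def Pjl_def V_def)
  moreover have "sets P3 = sets (distr M borel (X k) \<Otimes>\<^sub>M Pjl)"
    unfolding P3_def Pjl_def sets_distr by (intro sets_pair_measure_cong) auto
  ultimately have 2: "tv_le (distr M borel (X i) \<Otimes>\<^sub>M P3)
      (distr M borel (X i) \<Otimes>\<^sub>M (distr M borel (X k) \<Otimes>\<^sub>M Pjl))
      (beta_coef M (gen_sigma M X {k}) (gen_sigma M X {j, l}))"
    by (intro tv_le_pair Pi.prob_space_axioms P3.prob_space_axioms Pkjl.prob_space_axioms)
  have "sets (distr M (borel \<Otimes>\<^sub>M (borel \<Otimes>\<^sub>M (borel \<Otimes>\<^sub>M borel))) (\<lambda>\<omega>. (X i \<omega>, V \<omega>))) =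
      sets (distr M borel (X i) \<Otimes>\<^sub>M P3)"
    unfolding P3_def sets_distr by (intro sets_pair_measure_cong) auto
  from tv_le_trans[OF this 1 2 b1 b2] show "tv_le (distr M (borel \<Otimes>\<^sub>M (borel \<Otimes>\<^sub>M (borel \<Otimes>\<^sub>M borel)))
      (\<lambda>\<omega>. (X i \<omega>, (X k \<omega>, (X j \<omega>, X l \<omega>)))))
      (distr M borel (X i) \<Otimes>\<^sub>M (distr M borel (X k) \<Otimes>\<^sub>M Pjl))
      (beta_coef M (gen_sigma M X {i}) (gen_sigma M X {k, j, l}) +
       beta_coef M (gen_sigma M X {k}) (gen_sigma M X {j, l}))"
    by (simp add: V_def)
qed

text \<open>The covariance estimate with \<open>p = q / 2\<close> and \<open>L = 8 * K\<close>: 256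
  is 4 times the square of 8, and \<open>2 * b\<close> adds the errors of the two splits.\<close>

lemma far_covariance:
  assumes ik: "i \<in> I" "k \<in> I" "i \<noteq> k" and jl: "j \<in> I" "l \<in> I" "j \<noteq> l" and q2: "2 < q"
    and b1: "beta_coef M (gen_sigma M X {i}) (gen_sigma M X {k, j, l}) \<le> b"
    and b2: "beta_coef M (gen_sigma M X {k}) (gen_sigma M X {j, l}) \<le> b"
  shows "\<bar>expectation (\<lambda>\<omega>. (H (X i \<omega>) (X k \<omega>) - theta M X H i k) *
      (H (X j \<omega>) (X l \<omega>) - theta M X H j l))\<bar> \<le> 256 * K\<^sup>2 * (2 * b) powr (1 - 2 / q)"
proof -
  note [measurable] = X[OF ik(1)] X[OF ik(2)] X[OF jl(1)] X[OF jl(2)]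
  define Pjl where "Pjl = distr M (borel \<Otimes>\<^sub>M borel) (\<lambda>\<omega>. (X j \<omega>, X l \<omega>))"
  define Y where "Y = (\<lambda>\<omega>. (X i \<omega>, (X k \<omega>, (X j \<omega>, X l \<omega>))))"
  define P where "P = distr M (borel \<Otimes>\<^sub>M (borel \<Otimes>\<^sub>M (borel \<Otimes>\<^sub>M borel))) Y"
  define b' where "b' = beta_coef M (gen_sigma M X {i}) (gen_sigma M X {k, j, l}) +
       beta_coef M (gen_sigma M X {k}) (gen_sigma M X {j, l})"
  note tv = tv_le_decoupled[OF ik(1,2) jl(1,2), folded Pjl_def Y_def P_def b'_def]
  have b': "0 \<le> b'" "b' \<le> 2 * b" using tv(2,3) b1 b2 unfolding b'_def by auto
  have Y[measurable]: "Y \<in> measurable M (borel \<Otimes>\<^sub>M (borel \<Otimes>\<^sub>M (borel \<Otimes>\<^sub>M borel)))"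
    unfolding Y_def by measurable
  have pr: "prob_space P" "prob_space (distr M borel (X i))" "prob_space (distr M borel (X k))" "prob_space Pjl"
    unfolding P_def Pjl_def by (rule prob_space_distr; measurable)+
  have sets_P: "sets P = sets (distr M borel (X i) \<Otimes>\<^sub>M (distr M borel (X k) \<Otimes>\<^sub>M Pjl))"
    unfolding P_def Pjl_def sets_distr by (intro sets_pair_measure_cong) auto
  let ?a = "\<lambda>z. H (fst z) (snd z) - theta M X H i k"
  let ?c = "\<lambda>z. H (fst z) (snd z) - theta M X H j l"
  have "\<bar>\<integral>z. ?a (fst z, fst (snd z)) * ?c (snd (snd z)) \<partial>P\<bar> \<le> 4 * (8 * K)\<^sup>2 * b' powr (1 - 1 / (q / 2))"
  proof (rule tv_le_covariance[OF pr sets_P tv(1) b'(1)])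
    show "?a \<in> borel_measurable (distr M borel (X i) \<Otimes>\<^sub>M distr M borel (X k))" by measurable
    show "?c \<in> borel_measurable Pjl" unfolding Pjl_def by measurable
    show "(\<integral>\<^sup>+z. ennreal (\<bar>?a (fst z, fst (snd z))\<bar> powr (2 * (q / 2))) \<partial>P) \<le> ennreal ((8 * K) powr (2 * (q / 2)))"
      using centered_kernel_moment[OF ik] unfolding P_def by (subst nn_integral_distr) (auto simp: Y_def)
    show "(\<integral>\<^sup>+z. ennreal (\<bar>?c (snd (snd z))\<bar> powr (2 * (q / 2))) \<partial>P) \<le> ennreal ((8 * K) powr (2 * (q / 2)))"
      using centered_kernel_moment[OF jl] unfolding P_def by (subst nn_integral_distr) (auto simp: Y_def)
    show "(\<integral>\<^sup>+z. ennreal (\<bar>?c z\<bar> powr (2 * (q / 2))) \<partial>Pjl) \<le> ennreal ((8 * K) powr (2 * (q / 2)))"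
      using centered_kernel_moment[OF jl] unfolding Pjl_def by (subst nn_integral_distr) auto
  qed (use centered_kernel_pair_law_moment[OF ik] centered_pair_law_mean[OF ik] q2 enn2real_nonneg in auto)
  also have "(\<integral>z. ?a (fst z, fst (snd z)) * ?c (snd (snd z)) \<partial>P) =
      expectation (\<lambda>\<omega>. (H (X i \<omega>) (X k \<omega>) - theta M X H i k) * (H (X j \<omega>) (X l \<omega>) - theta M X H j l))"
    unfolding P_def by (subst integral_distr) (auto simp: Y_def)
  also have "4 * (8 * K)\<^sup>2 * b' powr (1 - 1 / (q / 2)) \<le> 256 * K\<^sup>2 * (2 * b) powr (1 - 2 / q)"
  proof -
    have "b' powr (1 - 2 / q) \<le> (2 * b) powr (1 - 2 / q)"
      using b' q2 by (intro powr_mono2) auto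
    thus ?thesis by (simp add: power_mult_distrib mult_left_mono)
  qed
  finally show ?thesis .
qed

end

lemma second_moment_near_far:
  fixes Y :: "'i \<Rightarrow> 'i \<Rightarrow> 'w \<Rightarrow> real"
  assumes I: "finite I" and AB: "0 \<le> A" "0 \<le> B"
    and int: "\<And>i k j l. i \<in> I \<Longrightarrow> k \<in> I \<Longrightarrow> i \<noteq> k \<Longrightarrow> j \<in> I \<Longrightarrow> l \<in> I \<Longrightarrow> j \<noteq> l \<Longrightarrow>
      integrable M (\<lambda>\<omega>. Y i k \<omega> * Y j l \<omega>)"
    and near: "\<And>i k j l. i \<in> I \<Longrightarrow> k \<in> I \<Longrightarrow> i \<noteq> k \<Longrightarrow> j \<in> I \<Longrightarrow> l \<in> I \<Longrightarrow> j \<noteq> l \<Longrightarrow>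
      (\<integral>\<omega>. Y i k \<omega> * Y j l \<omega> \<partial>M) \<le> A"
    and far: "\<And>i k j l. i \<in> I \<Longrightarrow> k \<in> I \<Longrightarrow> i \<noteq> k \<Longrightarrow> j \<in> I \<Longrightarrow> l \<in> I \<Longrightarrow> j \<noteq> l \<Longrightarrow>
      \<not> R i k \<Longrightarrow> \<not> R i j \<Longrightarrow> \<not> R i l \<Longrightarrow> \<not> R k j \<Longrightarrow> \<not> R k l \<Longrightarrow>
      (\<integral>\<omega>. Y i k \<omega> * Y j l \<omega> \<partial>M) \<le> B"
  shows "integrable M (\<lambda>\<omega>. (\<Sum>i\<in>I. \<Sum>k\<in>I - {i}. Y i k \<omega>)\<^sup>2)" (is ?int)
    and "(\<integral>\<omega>. (\<Sum>i\<in>I. \<Sum>k\<in>I - {i}. Y i k \<omega>)\<^sup>2 \<partial>M) \<le>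
      5 * real (card {(i, j). i \<in> I \<and> j \<in> I \<and> R i j}) * (real (card I))\<^sup>2 * A + (real (card I)) ^ 4 * B" (is ?le)
proof -
  define S where "S = Sigma I (\<lambda>i. I - {i})"
  have S: "finite S" "S \<subseteq> I \<times> I" using I unfolding S_def by auto
  have sq: "(\<Sum>i\<in>I. \<Sum>k\<in>I - {i}. Y i k \<omega>)\<^sup>2 =
      (\<Sum>p\<in>S. \<Sum>r\<in>S. Y (fst p) (snd p) \<omega> * Y (fst r) (snd r) \<omega>)" for \<omega>
    unfolding S_def power2_eq_square using I
    by (simp add: sum.Sigma sum_product case_prod_beta)
  have intS: "integrable M (\<lambda>\<omega>. Y (fst p) (snd p) \<omega> * Y (fst r) (snd r) \<omega>)" if "p \<in> S" "r \<in> S" for p r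
  proof -
    obtain i k j l where [simp]: "p = (i, k)" "r = (j, l)" by (cases p, cases r) auto
    have ids: "i \<in> I" "k \<in> I" "i \<noteq> k" "j \<in> I" "l \<in> I" "j \<noteq> l" using that unfolding S_def by auto
    show ?thesis using int[OF ids] by simp
  qed
  show ?int unfolding sq by (intro Bochner_Integration.integrable_sum intS)
  define \<nu> where "\<nu> i j = (if R i j then 1 else 0 :: real)" for i j
  \<comment> \<open>A majorant that charges \<open>A\<close> once for every close pair and
    \<open>B\<close> always. Its sum separates into five copies of a single count of close pairs,
    each with two free indices.\<close>
  define N where "N i k j l = A * (\<nu> i k + \<nu> i j + \<nu> i l + \<nu> k j + \<nu> k l) + B" for i k j l
  have N0: "0 \<le> N i k j l" for i k j l using AB unfolding N_def \<nu>_def by auto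
  have "(\<integral>\<omega>. (\<Sum>i\<in>I. \<Sum>k\<in>I - {i}. Y i k \<omega>)\<^sup>2 \<partial>M) =
      (\<Sum>p\<in>S. \<Sum>r\<in>S. \<integral>\<omega>. Y (fst p) (snd p) \<omega> * Y (fst r) (snd r) \<omega> \<partial>M)"
    unfolding sq by (simp add: Bochner_Integration.integral_sum intS integrable_sum)
  also have "\<dots> \<le> (\<Sum>p\<in>S. \<Sum>r\<in>S. N (fst p) (snd p) (fst r) (snd r))"
  proof (intro sum_mono)
    fix p r assume pr: "p \<in> S" "r \<in> S"
    obtain i k j l where [simp]: "p = (i, k)" "r = (j, l)" by (cases p, cases r) auto
    have ids: "i \<in> I" "k \<in> I" "i \<noteq> k" "j \<in> I" "l \<in> I" "j \<noteq> l" using pr unfolding S_def by auto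
    show "(\<integral>\<omega>. Y (fst p) (snd p) \<omega> * Y (fst r) (snd r) \<omega> \<partial>M) \<le> N (fst p) (snd p) (fst r) (snd r)"
    proof (cases "R i k \<or> R i j \<or> R i l \<or> R k j \<or> R k l")
      case True
      hence "1 \<le> \<nu> i k + \<nu> i j + \<nu> i l + \<nu> k j + \<nu> k l" unfolding \<nu>_def by auto
      hence "A * 1 \<le> A * (\<nu> i k + \<nu> i j + \<nu> i l + \<nu> k j + \<nu> k l)" by (rule mult_left_mono) fact
      thus ?thesis using near[OF ids] AB unfolding N_def by simp
    next
      case False
      thus ?thesis using far[OF ids] unfolding N_def \<nu>_def by simp
    qed
  qed
  \<comment> \<open>The majorant is nonnegative, so the restrictions to distinct indices may be
    dropped.\<close>
  also have "\<dots> \<le> (\<Sum>p\<in>I \<times> I. \<Sum>r\<in>I \<times> I. N (fst p) (snd p) (fst r) (snd r))"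
  proof -
    have "(\<Sum>p\<in>S. \<Sum>r\<in>S. N (fst p) (snd p) (fst r) (snd r)) \<le>
        (\<Sum>p\<in>S. \<Sum>r\<in>I \<times> I. N (fst p) (snd p) (fst r) (snd r))"
      using I S N0 by (intro sum_mono sum_mono2) auto
    also have "\<dots> \<le> (\<Sum>p\<in>I \<times> I. \<Sum>r\<in>I \<times> I. N (fst p) (snd p) (fst r) (snd r))"
      using I S N0 by (intro sum_mono2 sum_nonneg) auto
    finally show ?thesis .
  qed
  also have "\<dots> = (\<Sum>i\<in>I. \<Sum>k\<in>I. \<Sum>j\<in>I. \<Sum>l\<in>I. N i k j l)"
  proof -
    have pairs: "(\<Sum>p\<in>I \<times> I. g (fst p) (snd p)) = (\<Sum>i\<in>I. \<Sum>k\<in>I. g i k)" for g :: "'i \<Rightarrow> 'i \<Rightarrow> real"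
      by (simp add: sum.cartesian_product case_prod_beta)
    show ?thesis
      by (simp only: pairs[of "N _ _"] pairs[of "\<lambda>i k. \<Sum>j\<in>I. \<Sum>l\<in>I. N i k j l"])
  qed
  also have "\<dots> = 5 * (\<Sum>i\<in>I. \<Sum>j\<in>I. \<nu> i j) * (real (card I))\<^sup>2 * A + (real (card I)) ^ 4 * B"
    unfolding N_def
    by (simp add: sum.distrib sum_distrib_left[symmetric] sum_distrib_right[symmetric] power2_eq_square
        power4_eq_xxxx algebra_simps)
  also have "(\<Sum>i\<in>I. \<Sum>j\<in>I. \<nu> i j) = real (card {(i, j). i \<in> I \<and> j \<in> I \<and> R i j})"
  proof -
    have "(\<Sum>i\<in>I. \<Sum>j\<in>I. \<nu> i j) = (\<Sum>p\<in>I \<times> I. if R (fst p) (snd p) then 1 else 0)"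
      unfolding \<nu>_def by (simp add: sum.cartesian_product case_prod_beta)
    also have "\<dots> = (\<Sum>p\<in>{p \<in> I \<times> I. R (fst p) (snd p)}. 1)"
      using I by (intro sum.inter_filter[symmetric]) auto
    also have "{p \<in> I \<times> I. R (fst p) (snd p)} = {(i, j). i \<in> I \<and> j \<in> I \<and> R i j}" by auto
    finally show ?thesis by simp
  qed
  finally show ?le .
qed

lemma (in kernel_pair) centered_kernel_square:
  assumes "q = 2" and ik: "i \<in> I" "k \<in> I" "i \<noteq> k"
  shows "integrable M (\<lambda>\<omega>. (H (X i \<omega>) (X k \<omega>) - theta M X H i k)\<^sup>2)"
    and "expectation (\<lambda>\<omega>. (H (X i \<omega>) (X k \<omega>) - theta M X H i k)\<^sup>2) \<le> 64 * K\<^sup>2"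
proof -
  note [measurable] = X[OF ik(1)] X[OF ik(2)]
  have le: "(\<integral>\<^sup>+\<omega>. ennreal ((H (X i \<omega>) (X k \<omega>) - theta M X H i k)\<^sup>2) \<partial>M) \<le> ennreal (64 * K\<^sup>2)"
    using centered_kernel_moment[OF ik] \<open>q = 2\<close> by (simp add: power_mult_distrib)
  show int: "integrable M (\<lambda>\<omega>. (H (X i \<omega>) (X k \<omega>) - theta M X H i k)\<^sup>2)"
  proof (rule integrableI_bounded)
    show "(\<integral>\<^sup>+\<omega>. ennreal (norm ((H (X i \<omega>) (X k \<omega>) - theta M X H i k)\<^sup>2)) \<partial>M) < \<infinity>"
      using le by (simp add: order_le_less_trans[OF _ ennreal_less_top])
  qed measurable
  from le show "expectation (\<lambda>\<omega>. (H (X i \<omega>) (X k \<omega>) - theta M X H i k)\<^sup>2) \<le> 64 * K\<^sup>2"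
    by (subst (asm) nn_integral_eq_integral[OF int]) auto
qed

section \<open>Tail probabilities and the limit\<close>

lemma set_dist_ge:
  assumes "\<And>i j. i \<in> A \<Longrightarrow> j \<in> B \<Longrightarrow> r \<le> d i j"
  shows "r \<le> set_dist d A B"
  unfolding set_dist_def by (intro INF_greatest assms)

text \<open>Chebyshev's inequality for the centered sum. Since \<open>N * (N - 1)\<close> is at
  least \<open>N\<^sup>2 / 2\<close>, squaring loses a factor 4, which gives 1280 = 4 * 5 * 64 and
  1024 = 4 * 256.\<close>

lemma tail_bound:
  fixes X :: "'i \<Rightarrow> 'w \<Rightarrow> 'a::topological_space" and d :: "'i \<Rightarrow> 'i \<Rightarrow> ereal"
  assumes M: "prob_space M" and I: "finite I" "2 \<le> card I"
    and X: "\<And>i. i \<in> I \<Longrightarrow> X i \<in> borel_measurable M"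
    and H: "case_prod H \<in> borel_measurable (borel \<Otimes>\<^sub>M borel)" "\<And>x y. H x y = H y x"
    and fin: "Hnorm M I X H 2 < \<infinity>" "Hnorm M I X H q < \<infinity>" and q: "2 < q"
    and mix: "\<And>I1 I2. I1 \<subseteq> I \<Longrightarrow> I2 \<subseteq> I \<Longrightarrow> card I1 \<le> 1 \<Longrightarrow> card I2 \<le> 3 \<Longrightarrow> set_dist d I1 I2 \<ge> ereal r \<Longrightarrow>
      beta_coef M (gen_sigma M X I1) (gen_sigma M X I2) \<le> b"
    and e: "0 < e"
  defines "N \<equiv> real (card I)"
  shows "measure M {\<omega> \<in> space M. \<bar>Ssum I X H \<omega> / (N * (N - 1)) -
      (\<Sum>i\<in>I. \<Sum>k\<in>I - {i}. theta M X H i k) / (N * (N - 1))\<bar> > e} \<le>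
    (1280 * (real (tau2 I d r) * (enn2real (Hnorm M I X H 2))\<^sup>2 / N\<^sup>2) +
     1024 * ((enn2real (Hnorm M I X H q))\<^sup>2 * (2 * b) powr (1 - 2 / q))) / e\<^sup>2"
proof -
  interpret prob_space M by fact
  interpret K2: kernel_pair M X H I 2
    by unfold_locales (fact X, fact H(1), fact H(2), simp, fact fin(1))
  interpret Kq: kernel_pair M X H I q
    by unfold_locales (fact X, fact H(1), fact H(2), use q in simp, fact fin(2))
  define Y where "Y = (\<lambda>i k \<omega>. H (X i \<omega>) (X k \<omega>) - theta M X H i k)"
  let ?W = "\<lambda>\<omega>. \<Sum>i\<in>I. \<Sum>k\<in>I - {i}. Y i k \<omega>"
  define A where "A = 64 * (enn2real (Hnorm M I X H 2))\<^sup>2"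
  define B where "B = 256 * (enn2real (Hnorm M I X H q))\<^sup>2 * (2 * b) powr (1 - 2 / q)"
  have Ym: "Y i k \<in> borel_measurable M" if "i \<in> I" "k \<in> I" for i k
  proof -
    note [measurable] = X[OF that(1)] X[OF that(2)]
    show ?thesis unfolding Y_def by measurable
  qed
  have Y2: "integrable M (\<lambda>\<omega>. (Y i k \<omega>)\<^sup>2)" "expectation (\<lambda>\<omega>. (Y i k \<omega>)\<^sup>2) \<le> A"
    if "i \<in> I" "k \<in> I" "i \<noteq> k" for i k
    using K2.centered_kernel_square[OF refl that] unfolding Y_def A_def by auto
  have young: "\<bar>s * t\<bar> \<le> (1/2) * (s\<^sup>2 + t\<^sup>2)" for s t :: real
    using sum_squares_bound[of "\<bar>s\<bar>" "\<bar>t\<bar>"] by (simp add: abs_mult)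
  have YY: "integrable M (\<lambda>\<omega>. Y i k \<omega> * Y j l \<omega>)" "expectation (\<lambda>\<omega>. Y i k \<omega> * Y j l \<omega>) \<le> A"
    if ik: "i \<in> I" "k \<in> I" "i \<noteq> k" and jl: "j \<in> I" "l \<in> I" "j \<noteq> l" for i k j l
  proof -
    have int2: "integrable M (\<lambda>\<omega>. (1/2) * ((Y i k \<omega>)\<^sup>2 + (Y j l \<omega>)\<^sup>2))"
      using Y2(1)[OF ik] Y2(1)[OF jl] by auto
    show int: "integrable M (\<lambda>\<omega>. Y i k \<omega> * Y j l \<omega>)"
      by (rule Bochner_Integration.integrable_bound[OF int2])
        (use Ym[OF ik(1,2)] Ym[OF jl(1,2)] young in auto)
    have "expectation (\<lambda>\<omega>. Y i k \<omega> * Y j l \<omega>) \<le> expectation (\<lambda>\<omega>. (1/2) * ((Y i k \<omega>)\<^sup>2 + (Y j l \<omega>)\<^sup>2))"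
      by (rule integral_mono[OF int int2]) (rule order_trans[OF abs_ge_self young])
    also have "\<dots> \<le> A" using Y2[OF ik] Y2[OF jl] by simp
    finally show "expectation (\<lambda>\<omega>. Y i k \<omega> * Y j l \<omega>) \<le> A" .
  qed
  have far: "expectation (\<lambda>\<omega>. Y i k \<omega> * Y j l \<omega>) \<le> B"
    if ik: "i \<in> I" "k \<in> I" "i \<noteq> k" and jl: "j \<in> I" "l \<in> I" "j \<noteq> l"
      and sep: "\<not> d i k \<le> ereal r" "\<not> d i j \<le> ereal r" "\<not> d i l \<le> ereal r" "\<not> d k j \<le> ereal r" "\<not> d k l \<le> ereal r"
    for i k j l
  proof -
    \<comment> \<open>The block \<open>{j, l}\<close> is also measured against the size bound 3, so
      that one mixing bound serves both splits.\<close>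
    have c: "card {k, j, l} \<le> 3" "card {j, l} \<le> 3"
      by (auto intro: order_trans[OF card_insert_le_m1] simp: card_insert_if)
    have "beta_coef M (gen_sigma M X {i}) (gen_sigma M X {k, j, l}) \<le> b"
      by (rule mix) (use ik jl sep c in \<open>auto intro!: set_dist_ge\<close>)
    moreover have "beta_coef M (gen_sigma M X {k}) (gen_sigma M X {j, l}) \<le> b"
      by (rule mix) (use ik jl sep c in \<open>auto intro!: set_dist_ge\<close>)
    ultimately show ?thesis
      unfolding Y_def B_def
      using order_trans[OF abs_ge_self Kq.far_covariance[OF ik jl q]] by blast
  qed
  have AB: "0 \<le> A" "0 \<le> B" unfolding A_def B_def by auto
  note mom = second_moment_near_far[where Y = Y and R = "\<lambda>i j. d i j \<le> ereal r", OF I(1) AB YY far,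
      folded tau2_def N_def]
  have N: "2 \<le> N" unfolding N_def using I by simp
  have NN: "0 < N * (N - 1)" using N by simp
  have Wm: "?W \<in> borel_measurable M" by (intro borel_measurable_sum Ym) auto
  have W: "Ssum I X H \<omega> / (N * (N - 1)) - (\<Sum>i\<in>I. \<Sum>k\<in>I - {i}. theta M X H i k) / (N * (N - 1)) =
      ?W \<omega> / (N * (N - 1))" for \<omega>
    by (simp add: Ssum_def Y_def sum_subtractf diff_divide_distrib)
  have "measure M {\<omega> \<in> space M. \<bar>?W \<omega> / (N * (N - 1))\<bar> > e} \<le>
      measure M {\<omega> \<in> space M. \<bar>?W \<omega>\<bar> \<ge> e * (N * (N - 1))}"
  proof (rule finite_measure_mono)
    show "{\<omega> \<in> space M. \<bar>?W \<omega> / (N * (N - 1))\<bar> > e} \<subseteq> {\<omega> \<in> space M. \<bar>?W \<omega>\<bar> \<ge> e * (N * (N - 1))}"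
      using NN by (auto simp: abs_divide abs_of_pos[OF NN] pos_less_divide_eq)
    show "{\<omega> \<in> space M. \<bar>?W \<omega>\<bar> \<ge> e * (N * (N - 1))} \<in> sets M" using Wm by measurable
  qed
  also have "\<dots> \<le> expectation (\<lambda>\<omega>. (?W \<omega>)\<^sup>2) / (e * (N * (N - 1)))\<^sup>2"
    using mom(1) Wm NN e by (intro second_moment_method) auto
  also have "\<dots> \<le> (5 * real (tau2 I d r) * N\<^sup>2 * A + N ^ 4 * B) / (e * (N * (N - 1)))\<^sup>2"
    by (intro divide_right_mono mom(2)) auto
  also have "\<dots> \<le> (5 * real (tau2 I d r) * N\<^sup>2 * A + N ^ 4 * B) / (e\<^sup>2 * N ^ 4 / 4)"
  proof (rule divide_left_mono)
    have "N\<^sup>2 / 2 \<le> N * (N - 1)"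
      using N mult_left_mono[of "N / 2" "N - 1" N] by (simp add: power2_eq_square)
    hence "(N\<^sup>2 / 2)\<^sup>2 \<le> (N * (N - 1))\<^sup>2" by (intro power_mono) auto
    hence "e\<^sup>2 * (N\<^sup>2 / 2)\<^sup>2 \<le> e\<^sup>2 * (N * (N - 1))\<^sup>2" by (intro mult_left_mono) auto
    thus "e\<^sup>2 * N ^ 4 / 4 \<le> (e * (N * (N - 1)))\<^sup>2" by (simp add: power_mult_distrib power_divide)
    show "0 \<le> 5 * real (tau2 I d r) * N\<^sup>2 * A + N ^ 4 * B" using AB by simp
    show "0 < (e * (N * (N - 1)))\<^sup>2 * (e\<^sup>2 * N ^ 4 / 4)" using NN N e by (intro mult_pos_pos zero_less_power) auto
  qed
  also have "\<dots> = (20 * real (tau2 I d r) * A / N\<^sup>2 + 4 * B) / e\<^sup>2"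
    using N e by (simp add: field_simps power2_eq_square power4_eq_xxxx)
  finally show ?thesis unfolding W A_def B_def by (simp add: algebra_simps)
qed

theorem mainTheorem2:
  fixes M :: "'w measure"
    and I :: "nat \<Rightarrow> 'i set"
    and d :: "nat \<Rightarrow> 'i \<Rightarrow> 'i \<Rightarrow> ereal"
    and X :: "nat \<Rightarrow> 'i \<Rightarrow> 'w \<Rightarrow> real ^ 'd"
    and H :: "nat \<Rightarrow> real ^ 'd \<Rightarrow> real ^ 'd \<Rightarrow> real"
    and bnd :: "nat \<Rightarrow> enat \<Rightarrow> enat \<Rightarrow> real \<Rightarrow> real"
    and m :: "nat \<Rightarrow> real"
    and \<delta> :: real
  assumes M: "prob_space M"
    and I_fin: "\<And>n. finite (I n)" and I_card: "\<And>n. card (I n) = n"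
    and d_nonneg: "\<And>n i j. i \<in> I n \<Longrightarrow> j \<in> I n \<Longrightarrow> d n i j \<ge> 0"
    and d_refl: "\<And>n i. i \<in> I n \<Longrightarrow> d n i i = 0"
    and d_sym: "\<And>n i j. i \<in> I n \<Longrightarrow> j \<in> I n \<Longrightarrow> d n i j = d n j i"
    and d_tri: "\<And>n i j k. i \<in> I n \<Longrightarrow> j \<in> I n \<Longrightarrow> k \<in> I n \<Longrightarrow> d n i k \<le> d n i j + d n j k"
    and X_meas: "\<And>n i. i \<in> I n \<Longrightarrow> X n i \<in> borel_measurable M"
    \<comment> \<open>Assumption 1\<close>
    and A1: "\<And>n i j. i \<in> I n \<Longrightarrow> j \<in> I n \<Longrightarrow> i \<noteq> j \<Longrightarrow> d n i j \<ge> 1"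
    \<comment> \<open>Assumption 2\<close>
    and A2: "\<And>n n1 n2 r I1 I2. I1 \<subseteq> I n \<Longrightarrow> I2 \<subseteq> I n \<Longrightarrow> enat (card I1) \<le> n1 \<Longrightarrow>
               enat (card I2) \<le> n2 \<Longrightarrow> set_dist (d n) I1 I2 \<ge> ereal r \<Longrightarrow>
               beta_coef M (gen_sigma M (X n) I1) (gen_sigma M (X n) I2) \<le> bnd n n1 n2 r"
    \<comment> \<open>Assumption 3\<close>
    and H_meas: "\<And>n. case_prod (H n) \<in> borel_measurable borel"
    and H_sym: "\<And>n x y. H n x y = H n y x"
    and A3: "\<And>n i j. i \<in> I n \<Longrightarrow> j \<in> I n \<Longrightarrow> i \<noteq> j \<Longrightarrow>
               (\<integral>\<^sup>+ z. ennreal ((H n (fst z) (snd z))\<^sup>2) \<partial>(distr M borel (X n i) \<Otimes>\<^sub>M distr M borel (X n j))) < \<infinity>"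
    \<comment> \<open>conditions of the theorem\<close>
    and m_lim: "filterlim m at_top sequentially"
    and delta_pos: "\<delta> > 0"
    and cond1_fin: "eventually (\<lambda>n. Hnorm M (I n) (X n) (H n) 2 < \<infinity>) sequentially"
    and cond1: "(\<lambda>n. real (tau2 (I n) (d n) (m n)) * (enn2real (Hnorm M (I n) (X n) (H n) 2))\<^sup>2 / (real n)\<^sup>2)
                  \<longlonglongrightarrow> 0"
    and cond2_fin: "eventually (\<lambda>n. Hnorm M (I n) (X n) (H n) (2 + \<delta>) < \<infinity> \<and>
                        (SUP n'. ereal (bnd n' 1 3 (m n))) < \<infinity>) sequentially"
    and cond2: "(\<lambda>n. (enn2real (Hnorm M (I n) (X n) (H n) (2 + \<delta>)))\<^sup>2 *
                   (real_of_ereal (SUP n'. ereal (bnd n' 1 3 (m n)))) powr (\<delta> / (2 + \<delta>))) \<longlonglongrightarrow> 0"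
  shows "\<forall>\<epsilon>>0. (\<lambda>n. measure M {\<omega> \<in> space M.
            \<bar>Ssum (I n) (X n) (H n) \<omega> / (real n * (real n - 1))
             - (\<Sum>i\<in>I n. \<Sum>k\<in>I n - {i}. theta M (X n) (H n) i k) / (real n * (real n - 1))\<bar> > \<epsilon>})
          \<longlonglongrightarrow> 0"
proof (intro allI impI)
  fix \<epsilon> :: real assume \<epsilon>: "\<epsilon> > 0"
  define b where "b n = real_of_ereal (SUP n'. ereal (bnd n' 1 3 (m n)))" for n
  define K2 where "K2 n = enn2real (Hnorm M (I n) (X n) (H n) 2)" for n
  define Kq where "Kq n = enn2real (Hnorm M (I n) (X n) (H n) (2 + \<delta>))" for n
  have s: "1 - 2 / (2 + \<delta>) = \<delta> / (2 + \<delta>)" using delta_pos by (simp add: field_simps)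
  let ?f = "\<lambda>n. (1280 * (real (tau2 (I n) (d n) (m n)) * (K2 n)\<^sup>2 / (real n)\<^sup>2) +
      1024 * 2 powr (\<delta> / (2 + \<delta>)) * ((Kq n)\<^sup>2 * b n powr (\<delta> / (2 + \<delta>)))) / \<epsilon>\<^sup>2"
  have lim: "?f \<longlonglongrightarrow> 0"
  proof -
    have "?f \<longlonglongrightarrow> (1280 * 0 + 1024 * 2 powr (\<delta> / (2 + \<delta>)) * 0) / \<epsilon>\<^sup>2"
      using cond1[folded K2_def] cond2[folded Kq_def b_def] \<epsilon> by (intro tendsto_intros) auto
    thus ?thesis by simp
  qed
  have upper: "eventually (\<lambda>n. measure M {\<omega> \<in> space M.
            \<bar>Ssum (I n) (X n) (H n) \<omega> / (real n * (real n - 1))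
             - (\<Sum>i\<in>I n. \<Sum>k\<in>I n - {i}. theta M (X n) (H n) i k) / (real n * (real n - 1))\<bar> > \<epsilon>} \<le> ?f n) sequentially"
    using cond1_fin cond2_fin eventually_ge_at_top[of 2]
  proof eventually_elim
    case (elim n)
    have bnd: "bnd n 1 3 (m n) \<le> b n"
    proof -
      have up: "ereal (bnd n 1 3 (m n)) \<le> (SUP n'. ereal (bnd n' 1 3 (m n)))" by (rule SUP_upper) simp
      \<comment> \<open>The supremum lies above a real number and is finite from above by
        \<open>cond2_fin\<close>; hence \<open>real_of_ereal\<close> returns its true value and not
        the default 0.\<close>
      hence "\<bar>SUP n'. ereal (bnd n' 1 3 (m n))\<bar> \<noteq> \<infinity>" using elim by auto
      hence "ereal (b n) = (SUP n'. ereal (bnd n' 1 3 (m n)))" unfolding b_def by (rule ereal_real')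
      thus ?thesis using up by (metis ereal_less_eq(3))
    qed
    have mix: "beta_coef M (gen_sigma M (X n) I1) (gen_sigma M (X n) I2) \<le> b n"
      if "I1 \<subseteq> I n" "I2 \<subseteq> I n" "card I1 \<le> 1" "card I2 \<le> 3" "set_dist (d n) I1 I2 \<ge> ereal (m n)" for I1 I2
      using that by (intro order_trans[OF A2 bnd]) (auto simp: one_enat_def numeral_eq_enat)
    \<comment> \<open>Empty index sets are at distance \<infinity>, so they are admissible in
      \<open>mix\<close>, and their nonnegative coefficient lies below \<open>b n\<close>.
      Nonnegativity lets the factor 2 be pulled out of the power.\<close>
    have b0: "0 \<le> b n"
    proof -
      interpret prob_space M by (rule M)
      have sub: "gen_sigma M (X n) {} \<subseteq> events" by (rule gen_sigma_subset_sets) simp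
      have top: "space M \<in> gen_sigma M (X n) {}"
        using sets.top[of "gen_measure M (X n) {}"] by (simp add: sets_gen_measure)
      from beta_coef_nonneg[OF sub sub top top] mix[of "{}" "{}"] show ?thesis
        by (auto simp: set_dist_def)
    qed
    have Hm: "case_prod (H n) \<in> borel_measurable (borel \<Otimes>\<^sub>M borel)"
      using H_meas[of n] by (simp add: borel_prod)
    have card: "2 \<le> card (I n)" using elim I_card by simp
    have "1024 * ((Kq n)\<^sup>2 * (2 * b n) powr (1 - 2 / (2 + \<delta>))) =
        1024 * 2 powr (\<delta> / (2 + \<delta>)) * ((Kq n)\<^sup>2 * b n powr (\<delta> / (2 + \<delta>)))"
      using b0 by (simp add: s powr_mult)
    with tail_bound[OF M I_fin card X_meas Hm H_sym _ _ _ mix \<epsilon>, of "2 + \<delta>", folded K2_def Kq_def]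
    show ?case using elim delta_pos by (simp add: I_card)
  qed
  show "(\<lambda>n. measure M {\<omega> \<in> space M.
            \<bar>Ssum (I n) (X n) (H n) \<omega> / (real n * (real n - 1))
             - (\<Sum>i\<in>I n. \<Sum>k\<in>I n - {i}. theta M (X n) (H n) i k) / (real n * (real n - 1))\<bar> > \<epsilon>})
          \<longlonglongrightarrow> 0"
    by (rule tendsto_sandwich[OF _ upper tendsto_const lim]) simp
qed

end
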